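(* Let $\varphi:M^2\to N^n$ be a biconservative surface in a Riemannian manifold, and denote by $\lambda_1$ and $\lambda_2$ the principal curvatures of $M$. If $\lambda_1$ and $\lambda_2$ are constant functions on $M$, then $\nabla A_H=0$.
   Context: All manifolds, metrics and maps are smooth; all manifolds are connected and oriented. A surface $\varphi:M^2\to N^n$ is a Riemannian (isometric) immersion of a 2-dimensional Riemannian manifold into a Riemannian manifold. $B$ is the second fundamental form, $H=\frac12\operatorname{trace}B$ the mean curvature vector field, and $A_H$ the shape operator in the direction of $H$, with $\langle A_H(X),Y\rangle=\langle B(X,Y),H\rangle$. The stress-bienergy tensor of a surface is $S_2=-2|H|^2I+4A_H$ ($I$ the identity $(1,1)$-tensor), and $M$ is biconservative if $\operatorname{div}S_2=0$, where $\operatorname{div}T=\operatorname{trace}\nabla T=\sum_i(\nabla_{X_i}T)(X_i)$ for a local orthonormal frame $\{X_i\}$. The principal curvatures $\lambda_1\ge\lambda_2$ of $M$ are the eigenvalue functions of $A_H$. $\nabla$ is the Levi-Civita connection of $M$. *)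

theory Defs
  imports "HOL-Analysis.Analysis"
begin

section \<open>Smooth maps between Euclidean spaces\<close>

text \<open>\<open>C_on k S f\<close> is only used for open \<open>S\<close>, where it says that \<open>f\<close> is of class \<open>C\<^sup>k\<close>.\<close>

primrec C_on :: "nat \<Rightarrow> ('a::real_normed_vector) set \<Rightarrow> ('a \<Rightarrow> 'b::real_normed_vector) \<Rightarrow> bool" where
  "C_on 0 S f \<longleftrightarrow> continuous_on S f"
| "C_on (Suc k) S f \<longleftrightarrow> (\<forall>x\<in>S. f differentiable (at x)) \<and>
     (\<forall>v. C_on k S (\<lambda>x. frechet_derivative f (at x) v))"

definition smooth_on :: "('a::real_normed_vector) set \<Rightarrow> ('a \<Rightarrow> 'b::real_normed_vector) \<Rightarrow> bool" where
  "smooth_on S f \<longleftrightarrow> (\<forall>k. C_on k S f)"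


section \<open>Riemannian manifolds\<close>

text \<open>A chart is a pair of its domain and its coordinate map.\<close>

type_synonym ('a, 'n) chart = "'a set \<times> ('a \<Rightarrow> real ^ 'n)"

text \<open>
  A field of bilinear forms on an open set of \<open>\<real>\<^sup>n\<close>: \<open>g x u v\<close> is the value at the point \<open>x\<close>
  on the vectors \<open>u\<close>, \<open>v\<close>.
\<close>

type_synonym 'n form_field = "real ^ 'n \<Rightarrow> real ^ 'n \<Rightarrow> real ^ 'n \<Rightarrow> real"

definition coords :: "('a, 'n::finite) chart \<Rightarrow> (real ^ 'n) set" where
  "coords c = snd c ` fst c"

definition param :: "('a, 'n::finite) chart \<Rightarrow> real ^ 'n \<Rightarrow> 'a" where
  "param c = inv_into (fst c) (snd c)"

text \<open>The expression of a map in charts \<open>c\<close> and \<open>d\<close>, and the open set on which it is meaningful.\<close>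

definition local_rep ::
    "('a, 'm::finite) chart \<Rightarrow> ('b, 'n::finite) chart \<Rightarrow> ('a \<Rightarrow> 'b) \<Rightarrow> real ^ 'm \<Rightarrow> real ^ 'n" where
  "local_rep c d f = snd d \<circ> f \<circ> param c"

definition local_dom ::
    "('a, 'm::finite) chart \<Rightarrow> ('b, 'n::finite) chart \<Rightarrow> ('a \<Rightarrow> 'b) \<Rightarrow> (real ^ 'm) set" where
  "local_dom c d f = snd c ` {p \<in> fst c. f p \<in> fst d}"

definition is_chart :: "'a topology \<Rightarrow> ('a, 'n::finite) chart \<Rightarrow> bool" where
  "is_chart X c \<longleftrightarrow> openin X (fst c) \<and> open (coords c) \<and>
     homeomorphic_map (subtopology X (fst c)) (top_of_set (coords c)) (snd c)"

text \<open>
  The structure of an oriented Riemannian manifold: the underlying space, a smooth oriented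
  atlas, and for each chart \<open>c\<close> of the atlas the expression \<open>metric M c\<close> of the metric tensor
  in the coordinates of \<open>c\<close>.
\<close>

record ('a, 'n::finite) rmanifold =
  space_of :: "'a topology"
  atlas :: "('a, 'n) chart set"
  metric :: "('a, 'n) chart \<Rightarrow> 'n form_field"

definition inner_form :: "(real ^ 'n \<Rightarrow> real ^ 'n \<Rightarrow> real) \<Rightarrow> bool" where
  "inner_form b \<longleftrightarrow> bilinear b \<and> (\<forall>u v. b u v = b v u) \<and> (\<forall>u. u \<noteq> 0 \<longrightarrow> 0 < b u u)"

definition riemannian_metric_on :: "(real ^ 'n) set \<Rightarrow> ('n::finite) form_field \<Rightarrow> bool" where
  "riemannian_metric_on S g \<longleftrightarrow>
     (\<forall>x\<in>S. inner_form (g x)) \<and> (\<forall>u v. smooth_on S (\<lambda>x. g x u v))"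

text \<open>
  The transition map between charts is the local representation of the identity. Positivity of
  the Jacobians of all transition maps makes the atlas an orientation; the last clause is the
  transformation law of the metric tensor.
\<close>

definition riemannian_manifold :: "('a, 'n::finite) rmanifold \<Rightarrow> bool" where
  "riemannian_manifold M \<longleftrightarrow>
     Hausdorff_space (space_of M) \<and> second_countable (space_of M) \<and> connected_space (space_of M) \<and>
     (\<forall>c\<in>atlas M. is_chart (space_of M) c) \<and>
     (\<Union>c\<in>atlas M. fst c) = topspace (space_of M) \<and>
     (\<forall>c\<in>atlas M. \<forall>d\<in>atlas M. smooth_on (local_dom c d id) (local_rep c d id)) \<and>
     (\<forall>c\<in>atlas M. \<forall>d\<in>atlas M. \<forall>x\<in>local_dom c d id.
        0 < det (matrix (frechet_derivative (local_rep c d id) (at x)))) \<and>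
     (\<forall>c\<in>atlas M. riemannian_metric_on (coords c) (metric M c)) \<and>
     (\<forall>c\<in>atlas M. \<forall>d\<in>atlas M. \<forall>x\<in>local_dom c d id. \<forall>u v.
        metric M c x u v =
          metric M d (local_rep c d id x)
            (frechet_derivative (local_rep c d id) (at x) u)
            (frechet_derivative (local_rep c d id) (at x) v))"

definition smooth_map ::
    "('a, 'm::finite) rmanifold \<Rightarrow> ('b, 'n::finite) rmanifold \<Rightarrow> ('a \<Rightarrow> 'b) \<Rightarrow> bool" where
  "smooth_map M N f \<longleftrightarrow> continuous_map (space_of M) (space_of N) f \<and>
     (\<forall>c\<in>atlas M. \<forall>d\<in>atlas N. smooth_on (local_dom c d f) (local_rep c d f))"

definition isometric_immersion ::
    "('a, 'm::finite) rmanifold \<Rightarrow> ('b, 'n::finite) rmanifold \<Rightarrow> ('a \<Rightarrow> 'b) \<Rightarrow> bool" where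
  "isometric_immersion M N f \<longleftrightarrow> smooth_map M N f \<and>
     (\<forall>c\<in>atlas M. \<forall>d\<in>atlas N. \<forall>x\<in>local_dom c d f.
        inj (frechet_derivative (local_rep c d f) (at x)) \<and>
        (\<forall>u v. metric M c x u v =
           metric N d (local_rep c d f x)
             (frechet_derivative (local_rep c d f) (at x) u)
             (frechet_derivative (local_rep c d f) (at x) v)))"


section \<open>Riemannian geometry in coordinates\<close>

text \<open>
  In this section \<open>g\<close> and \<open>h\<close> are the expressions of the metrics of domain and target in charts
  \<open>c\<close> and \<open>d\<close>, and \<open>F\<close> is the expression of the map. A connection is written in coordinates as
  \<open>\<nabla>\<^sub>u V = D\<^sub>u V + \<Gamma>(u, V)\<close>; it is torsion free iff \<open>\<Gamma>\<close> is symmetric. The Levi-Civita connection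
  is the unique torsion free one that is compatible with the metric.
\<close>

definition levi_civita_at ::
    "('n::finite) form_field \<Rightarrow> real ^ 'n \<Rightarrow> (real ^ 'n \<Rightarrow> real ^ 'n \<Rightarrow> real ^ 'n) \<Rightarrow> bool" where
  "levi_civita_at g x \<Gamma> \<longleftrightarrow> bilinear \<Gamma> \<and> (\<forall>u v. \<Gamma> u v = \<Gamma> v u) \<and>
     (\<forall>u v w. frechet_derivative (\<lambda>y. g y v w) (at x) u = g x (\<Gamma> u v) w + g x v (\<Gamma> u w))"

definition levi_civita ::
    "('n::finite) form_field \<Rightarrow> real ^ 'n \<Rightarrow> real ^ 'n \<Rightarrow> real ^ 'n \<Rightarrow> real ^ 'n" where
  "levi_civita g x = (THE \<Gamma>. levi_civita_at g x \<Gamma>)"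

definition nabla ::
    "('n::finite) form_field \<Rightarrow> (real ^ 'n \<Rightarrow> real ^ 'n) \<Rightarrow> real ^ 'n \<Rightarrow> real ^ 'n \<Rightarrow> real ^ 'n" where
  "nabla g V x u = frechet_derivative V (at x) u + levi_civita g x u (V x)"

text \<open>The connection induced on vector fields \<open>W\<close> along \<open>F\<close>.\<close>

definition nabla_along ::
    "('n::finite) form_field \<Rightarrow> (real ^ 'm::finite \<Rightarrow> real ^ 'n) \<Rightarrow>
     (real ^ 'm \<Rightarrow> real ^ 'n) \<Rightarrow> real ^ 'm \<Rightarrow> real ^ 'm \<Rightarrow> real ^ 'n" where
  "nabla_along h F W x u =
     frechet_derivative W (at x) u + levi_civita h (F x) (frechet_derivative F (at x) u) (W x)"

text \<open>
  \<open>(\<nabla>\<^sub>u T) v = \<nabla>\<^sub>u (T V) - T (\<nabla>\<^sub>u V)\<close> for a \<open>(1,1)\<close>-tensor field \<open>T\<close>, where \<open>V\<close> is any vector field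
  with value \<open>v\<close> at \<open>x\<close>; we take the one with constant components.
\<close>

definition nabla_tensor ::
    "('n::finite) form_field \<Rightarrow> (real ^ 'n \<Rightarrow> real ^ 'n \<Rightarrow> real ^ 'n) \<Rightarrow>
     real ^ 'n \<Rightarrow> real ^ 'n \<Rightarrow> real ^ 'n \<Rightarrow> real ^ 'n" where
  "nabla_tensor g T x u v = nabla g (\<lambda>y. T y v) x u - T x (nabla g (\<lambda>_. v) x u)"

text \<open>
  An orthonormal basis of the tangent space at \<open>x\<close>, and the trace \<open>\<Sum>\<^sub>i b(X\<^sub>i, X\<^sub>i)\<close> of a
  vector-valued bilinear form. By lemma \<open>metric_trace_eq\<close> below the choice of basis does not
  matter.
\<close>

definition orthonormal_at :: "('n::finite) form_field \<Rightarrow> real ^ 'n \<Rightarrow> ('n \<Rightarrow> real ^ 'n) \<Rightarrow> bool" where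
  "orthonormal_at g x X \<longleftrightarrow> (\<forall>i j. g x (X i) (X j) = (if i = j then 1 else 0))"

definition metric_trace ::
    "('n::finite) form_field \<Rightarrow> real ^ 'n \<Rightarrow> (real ^ 'n \<Rightarrow> real ^ 'n \<Rightarrow> 'b) \<Rightarrow> 'b::real_vector" where
  "metric_trace g x b = (let X = (SOME X. orthonormal_at g x X) in \<Sum>i\<in>UNIV. b (X i) (X i))"

definition divergence ::
    "('n::finite) form_field \<Rightarrow> (real ^ 'n \<Rightarrow> real ^ 'n \<Rightarrow> real ^ 'n) \<Rightarrow> real ^ 'n \<Rightarrow> real ^ 'n" where
  "divergence g T x = metric_trace g x (nabla_tensor g T x)"

text \<open>
  Gauss formula: \<open>\<nabla>\<^sub>u (dF V) = dF (\<nabla>\<^sub>u V) + B(u, V)\<close>, again with \<open>V\<close> of constant components.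
\<close>

definition second_fundamental_form ::
    "('m::finite) form_field \<Rightarrow> ('n::finite) form_field \<Rightarrow> (real ^ 'm \<Rightarrow> real ^ 'n) \<Rightarrow>
     real ^ 'm \<Rightarrow> real ^ 'm \<Rightarrow> real ^ 'm \<Rightarrow> real ^ 'n" where
  "second_fundamental_form g h F x u v =
     nabla_along h F (\<lambda>y. frechet_derivative F (at y) v) x u
     - frechet_derivative F (at x) (nabla g (\<lambda>_. v) x u)"

definition mean_curvature ::
    "2 form_field \<Rightarrow> ('n::finite) form_field \<Rightarrow> (real ^ 2 \<Rightarrow> real ^ 'n) \<Rightarrow> real ^ 2 \<Rightarrow> real ^ 'n" where
  "mean_curvature g h F x = (1 / 2) *\<^sub>R metric_trace g x (second_fundamental_form g h F x)"

text \<open>The shape operator in the direction of a vector \<open>\<eta>\<close> at \<open>F x\<close>.\<close>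

definition shape_operator ::
    "('m::finite) form_field \<Rightarrow> ('n::finite) form_field \<Rightarrow> (real ^ 'm \<Rightarrow> real ^ 'n) \<Rightarrow>
     real ^ 'm \<Rightarrow> real ^ 'n \<Rightarrow> real ^ 'm \<Rightarrow> real ^ 'm" where
  "shape_operator g h F x \<eta> =
     (THE A. \<forall>u v. g x (A u) v = h (F x) (second_fundamental_form g h F x u v) \<eta>)"

definition shape_H ::
    "2 form_field \<Rightarrow> ('n::finite) form_field \<Rightarrow> (real ^ 2 \<Rightarrow> real ^ 'n) \<Rightarrow>
     real ^ 2 \<Rightarrow> real ^ 2 \<Rightarrow> real ^ 2" where
  "shape_H g h F x = shape_operator g h F x (mean_curvature g h F x)"

definition stress_bienergy ::
    "2 form_field \<Rightarrow> ('n::finite) form_field \<Rightarrow> (real ^ 2 \<Rightarrow> real ^ 'n) \<Rightarrow>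
     real ^ 2 \<Rightarrow> real ^ 2 \<Rightarrow> real ^ 2" where
  "stress_bienergy g h F x v =
     (- 2 * h (F x) (mean_curvature g h F x) (mean_curvature g h F x)) *\<^sub>R v
     + 4 *\<^sub>R shape_H g h F x v"


section \<open>Surfaces\<close>

text \<open>
  The objects above are the components of globally defined tensors, so a condition on them at a
  point does not depend on the charts \<open>c\<close> and \<open>d\<close> in which it is read; it is imposed in all pairs
  of charts around the point and its image.
\<close>

definition biconservative ::
    "('a, 2) rmanifold \<Rightarrow> ('b, 'n::finite) rmanifold \<Rightarrow> ('a \<Rightarrow> 'b) \<Rightarrow> bool" where
  "biconservative M N f \<longleftrightarrow>
     (\<forall>c\<in>atlas M. \<forall>d\<in>atlas N. \<forall>x\<in>local_dom c d f.
        divergence (metric M c)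
          (stress_bienergy (metric M c) (metric N d) (local_rep c d f)) x = 0)"

text \<open>
  \<open>A\<^sub>H\<close> is self-adjoint on a plane, so its set of eigenvalues together with \<open>l\<^sub>1 \<ge> l\<^sub>2\<close> determines
  \<open>l\<^sub>1\<close> and \<open>l\<^sub>2\<close>, also at points with a double eigenvalue.
\<close>

definition principal_curvatures ::
    "('a, 2) rmanifold \<Rightarrow> ('b, 'n::finite) rmanifold \<Rightarrow> ('a \<Rightarrow> 'b) \<Rightarrow>
     ('a \<Rightarrow> real) \<Rightarrow> ('a \<Rightarrow> real) \<Rightarrow> bool" where
  "principal_curvatures M N f l\<^sub>1 l\<^sub>2 \<longleftrightarrow>
     (\<forall>c\<in>atlas M. \<forall>d\<in>atlas N. \<forall>p\<in>fst c. f p \<in> fst d \<longrightarrow>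
        l\<^sub>1 p \<ge> l\<^sub>2 p \<and>
        {\<mu>. \<exists>v. v \<noteq> 0 \<and>
           shape_H (metric M c) (metric N d) (local_rep c d f) (snd c p) v = \<mu> *\<^sub>R v} = {l\<^sub>1 p, l\<^sub>2 p})"

definition parallel_shape_H ::
    "('a, 2) rmanifold \<Rightarrow> ('b, 'n::finite) rmanifold \<Rightarrow> ('a \<Rightarrow> 'b) \<Rightarrow> bool" where
  "parallel_shape_H M N f \<longleftrightarrow>
     (\<forall>c\<in>atlas M. \<forall>d\<in>atlas N. \<forall>x\<in>local_dom c d f. \<forall>u v.
        nabla_tensor (metric M c)
          (shape_H (metric M c) (metric N d) (local_rep c d f)) x u v = 0)"


section \<open>Well-definedness\<close>

lemma inner_form_bilinear: "inner_form b \<Longrightarrow> bilinear b"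
  by (simp add: inner_form_def)

lemma inner_form_eqI:
  assumes "inner_form b" "\<And>w. b a w = b a' w"
  shows "a = a'"
proof -
  have "b (a - a') (a - a') = 0"
    using assms(2)[of "a - a'"] inner_form_bilinear[OF assms(1)] by (simp add: bilinear_lsub)
  then show ?thesis
    using assms(1) by (metis inner_form_def less_irrefl right_minus_eq)
qed

lemma inner_form_riesz:
  fixes b :: "real ^ 'n::finite \<Rightarrow> real ^ 'n \<Rightarrow> real"
  assumes b: "inner_form b" and L: "linear L"
  shows "\<exists>!a. \<forall>w. b a w = L w"
proof -
  define f where "f a = (\<chi> i. b a (axis i 1))" for a
  have bl: "bilinear b" using b by (rule inner_form_bilinear)
  have lin: "linear f"
    by (rule linearI) (simp_all add: f_def vec_eq_iff bilinear_ladd[OF bl] bilinear_lmul[OF bl])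
  have expand: "l w = (\<Sum>i\<in>UNIV. w $ i * l (axis i 1))" if "linear l" for l :: "real ^ 'n \<Rightarrow> real" and w
  proof -
    have "l w = l (\<Sum>i\<in>UNIV. w $ i *\<^sub>R axis i 1)"
      using basis_expansion[of w] by (simp add: scalar_mult_eq_scaleR)
    also have "\<dots> = (\<Sum>i\<in>UNIV. w $ i * l (axis i 1))"
      by (simp add: linear_sum[OF that] linear_cmul[OF that])
    finally show ?thesis .
  qed
  have key: "\<forall>w. b a w = l w" if "linear l" "f a = (\<chi> i. l (axis i 1))" for a l
  proof
    fix w
    have "\<And>i. b a (axis i 1) = l (axis i 1)" using that(2) by (simp add: f_def vec_eq_iff)
    moreover have "linear (b a)" using bl by (simp add: bilinear_def)
    ultimately show "b a w = l w" using expand[of "b a" w] expand[OF that(1), of w] by simp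
  qed
  have "inj f"
  proof (rule injI)
    fix a a' assume "f a = f a'"
    then have "f a = (\<chi> i. b a' (axis i 1))" by (simp add: f_def)
    moreover have "linear (b a')" using bl by (simp add: bilinear_def)
    ultimately show "a = a'" using key inner_form_eqI[OF b] by blast
  qed
  then have "surj f" using lin linear_injective_imp_surjective by blast
  then obtain a where "f a = (\<chi> i. L (axis i 1))" by (metis surjD)
  then have "\<forall>w. b a w = L w" using key[OF L] by blast
  then show ?thesis using inner_form_eqI[OF b] by metis
qed

lemma levi_civita_exists_unique:
  fixes g :: "('n::finite) form_field"
  assumes S: "open S" "x \<in> S" and g: "riemannian_metric_on S g"
  shows "\<exists>!\<Gamma>. levi_civita_at g x \<Gamma>"
proof -
  have I: "inner_form (g y)" if "y \<in> S" for y using g that by (simp add: riemannian_metric_on_def)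
  note b = I[OF S(2)]
  have bl: "bilinear (g x)" using b by (rule inner_form_bilinear)
  have sym: "g x u v = g x v u" for u v using b by (simp add: inner_form_def)
  have df: "(\<lambda>y. g y v w) differentiable (at x)" for v w
  proof -
    have "C_on (Suc 0) S (\<lambda>y. g y v w)" using g by (auto simp: riemannian_metric_on_def smooth_on_def)
    then show ?thesis using S(2) by simp
  qed
  define D where "D u v w = frechet_derivative (\<lambda>y. g y v w) (at x) u" for u v w
  have hd: "((\<lambda>y. g y v w) has_derivative (\<lambda>u. D u v w)) (at x)" for v w
    using df[of v w] unfolding D_def frechet_derivative_works by simp
  have lin1: "linear (\<lambda>u. D u v w)" for v w using hd has_derivative_linear by blast
  have uniq: "D u v w = d u"
    if "(f has_derivative d) (at x)" "\<And>y. y \<in> S \<Longrightarrow> f y = g y v w" for f d u v w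
  proof -
    have "((\<lambda>y. g y v w) has_derivative d) (at x)"
      by (rule has_derivative_transform_within_open[OF that(1) S]) (use that(2) in auto)
    then have "(\<lambda>u. D u v w) = d" using hd has_derivative_unique by blast
    then show ?thesis by metis
  qed
  have Dsym: "D u v w = D u w v" for u v w
    by (rule uniq[OF hd]) (use I in \<open>simp add: inner_form_def\<close>)
  have Dadd: "D u (v + v') w = D u v w + D u v' w" for u v v' w
    by (rule uniq[OF has_derivative_add[OF hd hd]])
       (use I inner_form_bilinear bilinear_ladd in metis)
  have Dmul: "D u (r *\<^sub>R v) w = r * D u v w" for u r v w
    by (rule uniq[OF has_derivative_mult_right[OF hd]])
       (use I inner_form_bilinear bilinear_lmul in \<open>metis real_scaleR_def\<close>)
  define K where "K u v w = (D u v w + D v u w - D w u v) / 2" for u v w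
  have D1: "D (u + u') v w = D u v w + D u' v w" "D (r *\<^sub>R u) v w = r * D u v w" for u u' r v w
    using linear_add[OF lin1] linear_cmul[OF lin1] by auto
  have D3: "D u v (w + w') = D u v w + D u v w'" "D u v (r *\<^sub>R w) = r * D u v w" for u v w w' r
    using Dadd Dmul Dsym by metis+
  have linK: "linear (K u v)" for u v
    by (rule linearI) (simp_all add: K_def D1 D3 Dadd Dmul field_simps)
  have Ksym: "K u v w = K v u w" for u v w
    unfolding K_def using Dsym[of w u v] by simp
  have KD: "K u v w + K u w v = D u v w" for u v w
    unfolding K_def using Dsym[of u v w] Dsym[of v u w] Dsym[of w u v] by (simp add: field_simps)
  define \<Gamma> where "\<Gamma> u v = (THE a. \<forall>w. g x a w = K u v w)" for u v
  have G: "g x (\<Gamma> u v) w = K u v w" for u v w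
    using theI'[OF inner_form_riesz[OF b linK, of u v]] by (simp add: \<Gamma>_def)
  have Gsym: "\<Gamma> u v = \<Gamma> v u" for u v
    by (rule inner_form_eqI[OF b]) (simp add: G Ksym[of u v])
  have Glin: "linear (\<lambda>u. \<Gamma> u v)" for v
    by (rule linearI; rule inner_form_eqI[OF b])
       (simp_all add: G bilinear_ladd[OF bl] bilinear_lmul[OF bl] K_def D1 D3 Dadd Dmul field_simps)
  have ex: "levi_civita_at g x \<Gamma>"
    unfolding levi_civita_at_def
  proof (intro conjI allI)
    have "(\<lambda>v. \<Gamma> v u) = \<Gamma> u" for u using Gsym by blast
    then have "linear (\<Gamma> u)" for u using Glin[of u] by simp
    then show "bilinear \<Gamma>" using Glin by (simp add: bilinear_def)
    show "\<Gamma> u v = \<Gamma> v u" for u v by (rule Gsym)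
    show "frechet_derivative (\<lambda>y. g y v w) (at x) u = g x (\<Gamma> u v) w + g x v (\<Gamma> u w)" for u v w
      unfolding sym[of v] G KD by (simp add: D_def)
  qed
  have un: "\<Gamma>' = \<Gamma>" if "levi_civita_at g x \<Gamma>'" for \<Gamma>'
  proof (intro ext, rule inner_form_eqI[OF b])
    fix u v w
    have s: "\<Gamma>' u v = \<Gamma>' v u" for u v using that by (simp add: levi_civita_at_def)
    have e: "D u v w = g x (\<Gamma>' u v) w + g x (\<Gamma>' u w) v" for u v w
      using that sym[of v] by (simp add: levi_civita_at_def D_def)
    show "g x (\<Gamma>' u v) w = g x (\<Gamma> u v) w"
      unfolding G K_def e using s[of u v] s[of u w] s[of v w] by simp
  qed
  show ?thesis using ex un by blast
qed

lemma levi_civita_levi_civita_at: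
  assumes "open S" "x \<in> S" "riemannian_metric_on S g"
  shows "levi_civita_at g x (levi_civita g x)"
  unfolding levi_civita_def using theI'[OF levi_civita_exists_unique[OF assms]] .

lemma inner_form_representation:
  fixes b \<beta> :: "real ^ 'n::finite \<Rightarrow> real ^ 'n \<Rightarrow> real"
  assumes b: "inner_form b" and \<beta>: "\<And>u. linear (\<beta> u)"
  shows "\<exists>!A. \<forall>u v. b (A u) v = \<beta> u v"
proof -
  obtain A where A: "\<forall>u v. b (A u) v = \<beta> u v"
    using inner_form_riesz[OF b \<beta>] by metis
  moreover have "A' = A" if "\<forall>u v. b (A' u) v = \<beta> u v" for A'
    by (rule ext, rule inner_form_eqI[OF b]) (simp add: A that)
  ultimately show ?thesis by blast
qed

lemma bilinear_sum_left: "bilinear b \<Longrightarrow> b (\<Sum>i\<in>S. c i *\<^sub>R X i) w = (\<Sum>i\<in>S. c i *\<^sub>R b (X i) w)"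
proof -
  assume "bilinear b"
  then have l: "linear (\<lambda>x. b x w)" by (simp add: bilinear_def)
  show ?thesis using linear_sum[OF l, of "\<lambda>i. c i *\<^sub>R X i" S] linear_cmul[OF l] by simp
qed

lemma bilinear_sum_right: "bilinear b \<Longrightarrow> b w (\<Sum>i\<in>S. c i *\<^sub>R X i) = (\<Sum>i\<in>S. c i *\<^sub>R b w (X i))"
  unfolding bilinear_def by (simp add: linear_sum linear_cmul)

lemma orthonormal_exists:
  fixes g :: "('n::finite) form_field"
  assumes g: "inner_form (g x)"
  shows "\<exists>X. orthonormal_at g x X"
proof -
  have bl: "bilinear (g x)" using g by (rule inner_form_bilinear)
  have sym: "g x u v = g x v u" for u v using g by (simp add: inner_form_def)
  have "\<exists>X. \<forall>i\<in>S. \<forall>j\<in>S. g x (X i) (X j) = (if i = j then 1 else 0)" for S :: "'n set"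
    using finite[of S]
  proof (induction S rule: finite_induct)
    case empty
    then show ?case by simp
  next
    case (insert k S)
    then obtain X where X: "\<And>i j. i \<in> S \<Longrightarrow> j \<in> S \<Longrightarrow> g x (X i) (X j) = (if i = j then 1 else 0)"
      by blast
    have "dim (X ` S) \<le> card S"
      using dim_le_card'[of "X ` S"] card_image_le[of S X] insert(1) by simp
    also have "card S < CARD('n)" using insert(2) by (intro psubset_card_mono) auto
    finally have "span (X ` S) \<noteq> UNIV"
      by (metis DIM_cart DIM_real dim_UNIV dim_span mult.right_neutral nat_less_le)
    then obtain v where v: "v \<notin> span (X ` S)" by blast
    define w where "w = v - (\<Sum>i\<in>S. g x v (X i) *\<^sub>R X i)"
    have "(\<Sum>i\<in>S. g x v (X i) *\<^sub>R X i) \<in> span (X ` S)"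
      by (intro span_sum span_scale span_base) auto
    then have "w \<noteq> 0" using v unfolding w_def by auto
    then have pos: "0 < g x w w" using g by (simp add: inner_form_def)
    have orth: "g x w (X j) = 0" if "j \<in> S" for j
    proof -
      have "g x w (X j) = g x v (X j) - (\<Sum>i\<in>S. g x v (X i) * g x (X i) (X j))"
        unfolding w_def by (simp add: bilinear_lsub[OF bl] bilinear_sum_left[OF bl])
      also have "(\<Sum>i\<in>S. g x v (X i) * g x (X i) (X j)) = (\<Sum>i\<in>S. if i = j then g x v (X j) else 0)"
        by (rule sum.cong) (use that in \<open>auto simp: X\<close>)
      also have "\<dots> = g x v (X j)" using that insert(1) by simp
      finally show ?thesis by simp
    qed
    define Y where "Y = X(k := (1 / sqrt (g x w w)) *\<^sub>R w)"
    have Yk: "Y k = (1 / sqrt (g x w w)) *\<^sub>R w" by (simp add: Y_def)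
    have YS: "Y i = X i" if "i \<in> S" for i using that insert(2) by (auto simp: Y_def)
    have kk: "g x (Y k) (Y k) = 1"
      using pos by (simp add: Yk bilinear_lmul[OF bl] bilinear_rmul[OF bl] field_simps)
    have ks: "g x (Y k) (Y j) = 0" if "j \<in> S" for j
      using orth[OF that] by (simp add: Yk YS[OF that] bilinear_lmul[OF bl])
    have sk: "g x (Y j) (Y k) = 0" if "j \<in> S" for j
      using ks[OF that] sym[of "Y j" "Y k"] by simp
    have "g x (Y i) (Y j) = (if i = j then 1 else 0)" if "i \<in> insert k S" "j \<in> insert k S" for i j
      using that kk ks sk X YS insert(2) by (cases "i = k"; cases "j = k") auto
    then show ?case by blast
  qed
  from this[of UNIV] show ?thesis by (auto simp: orthonormal_at_def)
qed

lemma orthonormal_expand: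
  fixes g :: "('n::finite) form_field"
  assumes g: "inner_form (g x)" and X: "orthonormal_at g x X"
  shows "v = (\<Sum>i\<in>UNIV. g x v (X i) *\<^sub>R X i)"
proof -
  have bl: "bilinear (g x)" using g by (rule inner_form_bilinear)
  define f where "f w = (\<chi> i. g x w (X i))" for w
  have lin: "linear f"
    by (rule linearI) (simp_all add: f_def vec_eq_iff bilinear_ladd[OF bl] bilinear_lmul[OF bl])
  have f: "f (\<Sum>i\<in>UNIV. c i *\<^sub>R X i) = (\<chi> i. c i)" for c
  proof -
    have "(\<Sum>i\<in>UNIV. c i * g x (X i) (X j)) = c j" for j
      using X by (simp add: orthonormal_at_def if_distrib[of "\<lambda>t. _ * t"] cong: if_cong)
    then show ?thesis by (simp add: f_def vec_eq_iff bilinear_sum_left[OF bl])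
  qed
  have "surj f"
  proof (rule surjI)
    show "f (\<Sum>i\<in>UNIV. y $ i *\<^sub>R X i) = y" for y by (simp add: f)
  qed
  then have "inj f" using lin linear_surjective_imp_injective by blast
  moreover have "f v = f (\<Sum>i\<in>UNIV. g x v (X i) *\<^sub>R X i)" by (simp add: f) (simp add: f_def)
  ultimately show ?thesis by (meson injD)
qed

lemma metric_trace_eq:
  fixes g :: "('n::finite) form_field"
  assumes g: "inner_form (g x)" and X: "orthonormal_at g x X" and b: "bilinear b"
  shows "metric_trace g x b = (\<Sum>i\<in>UNIV. b (X i) (X i))"
proof -
  define Y where "Y = (SOME Y. orthonormal_at g x Y)"
  have Y: "orthonormal_at g x Y" unfolding Y_def using orthonormal_exists[of g x, OF g] by (rule someI_ex)
  have bl: "bilinear (g x)" using g by (rule inner_form_bilinear)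
  have sym: "g x u v = g x v u" for u v using g by (simp add: inner_form_def)
  have c: "(\<Sum>j\<in>UNIV. g x (Y j) (X i) * g x (Y j) (X k)) = (if i = k then 1 else 0)" for i k
  proof -
    have "(if i = k then 1 else 0) = g x (\<Sum>j\<in>UNIV. g x (X i) (Y j) *\<^sub>R Y j) (X k)"
      using X orthonormal_expand[of g x, OF g Y, of "X i"] by (simp add: orthonormal_at_def)
    also have "\<dots> = (\<Sum>j\<in>UNIV. g x (Y j) (X i) * g x (Y j) (X k))"
      by (simp add: bilinear_sum_left[OF bl] sym[of "X i"])
    finally show ?thesis by simp
  qed
  have "b (Y j) (Y j) = (\<Sum>i\<in>UNIV. \<Sum>k\<in>UNIV. (g x (Y j) (X i) * g x (Y j) (X k)) *\<^sub>R b (X i) (X k))" for j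
  proof -
    have e: "(\<Sum>i\<in>UNIV. g x (Y j) (X i) *\<^sub>R X i) = Y j"
      by (rule orthonormal_expand[of g x, OF g X, symmetric])
    have "(\<Sum>i\<in>UNIV. \<Sum>k\<in>UNIV. (g x (Y j) (X i) * g x (Y j) (X k)) *\<^sub>R b (X i) (X k)) =
        (\<Sum>i\<in>UNIV. g x (Y j) (X i) *\<^sub>R b (X i) (Y j))"
      by (simp only: scaleR_scaleR[symmetric] scaleR_sum_right[symmetric]
            bilinear_sum_right[OF b, symmetric] e)
    also have "\<dots> = b (Y j) (Y j)"
      by (simp only: bilinear_sum_left[OF b, symmetric] e)
    finally show ?thesis by simp
  qed
  then have "(\<Sum>j\<in>UNIV. b (Y j) (Y j)) =
      (\<Sum>j\<in>UNIV. \<Sum>i\<in>UNIV. \<Sum>k\<in>UNIV. (g x (Y j) (X i) * g x (Y j) (X k)) *\<^sub>R b (X i) (X k))"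
    by simp
  also have "\<dots> = (\<Sum>i\<in>UNIV. \<Sum>k\<in>UNIV. \<Sum>j\<in>UNIV. (g x (Y j) (X i) * g x (Y j) (X k)) *\<^sub>R b (X i) (X k))"
    by (subst sum.swap, rule sum.cong[OF refl], subst sum.swap, rule refl)
  also have "\<dots> = (\<Sum>i\<in>UNIV. \<Sum>k\<in>UNIV. (if i = k then 1 else 0) *\<^sub>R b (X i) (X k))"
    by (simp only: scaleR_sum_left[symmetric] c)
  also have "\<dots> = (\<Sum>i\<in>UNIV. b (X i) (X i))"
    by (simp add: if_distrib[of "\<lambda>t. t *\<^sub>R _"] cong: if_cong)
  finally show ?thesis by (simp add: metric_trace_def Y_def Let_def)
qed

end

theory Submission
  imports Defs
begin

text \<open>
  Since \<open>trace A\<^sub>H = \<langle>trace B, H\<rangle> = 2|H|\<^sup>2\<close>, constant principal curvatures make \<open>|H|\<^sup>2\<close> constant, and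
  biconservativity then says that \<open>A = A\<^sub>H\<close> itself is divergence free. If \<open>l\<^sub>1 = l\<^sub>2\<close>, then
  \<open>A = l\<^sub>1 I\<close> is parallel. Otherwise differentiate the equation
  \<open>A\<^sup>2 = (l\<^sub>1 + l\<^sub>2) A - l\<^sub>1 l\<^sub>2 I\<close>, whose coefficients are constant: in an orthonormal basis
  \<open>e\<^sub>1, e\<^sub>2\<close> of eigenvectors at one point, the diagonal entries of \<open>\<nabla>\<^sub>u A\<close> vanish. As \<open>\<nabla>\<^sub>u A\<close> is
  self-adjoint, it interchanges \<open>e\<^sub>1\<close> and \<open>e\<^sub>2\<close> up to one factor \<open>n(u)\<close>, and
  \<open>0 = div A = n(e\<^sub>1) e\<^sub>2 + n(e\<^sub>2) e\<^sub>1\<close> forces \<open>n = 0\<close>. This is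
  \<open>parallel_of_divergence_free\<close>. Working with the equation instead of with the eigenvectors
  avoids the choice of a differentiable eigenframe; only algebra at a single point is left.

  The argument needs \<open>A\<close> to be a differentiable field of self-adjoint endomorphisms.
  Self-adjointness comes down to the symmetry of the second derivative of the map
  (\<open>second_derivative_symmetric\<close>). The Levi-Civita connection, the vectors dual to the
  coordinates (which express the trace) and the shape operator are all given implicitly, by their
  products with arbitrary vectors; such a field is differentiable as soon as these products are
  (\<open>differentiable_riesz\<close>).
\<close>

section \<open>Differentiating fields of linear and bilinear maps\<close>

lemma linear_expand:
  fixes T :: "real ^ 'k::finite \<Rightarrow> 'c::real_vector"
  assumes "linear T"
  shows "T w = (\<Sum>i\<in>UNIV. (w $ i) *\<^sub>R T (axis i 1))"
proof -
  have "T w = T (\<Sum>i\<in>UNIV. (w $ i) *\<^sub>R axis i 1)"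
    using basis_expansion[of w] by (simp add: scalar_mult_eq_scaleR)
  then show ?thesis
    by (simp add: linear_sum[OF assms] linear_cmul[OF assms])
qed

lemma has_derivative_frechet:
  "f differentiable (at x) \<Longrightarrow> (f has_derivative frechet_derivative f (at x)) (at x)"
  by (simp add: frechet_derivative_works)

lemma frechet_derivative_eqI:
  "(f has_derivative f') (at x) \<Longrightarrow> frechet_derivative f (at x) = f'"
  using frechet_derivative_at by force

lemma frechet_derivative_cong_open:
  assumes "open S" "x \<in> S" "\<And>y. y \<in> S \<Longrightarrow> f y = k y" "k differentiable (at x)"
  shows "frechet_derivative f (at x) = frechet_derivative k (at x)"
  by (rule frechet_derivative_eqI, rule has_derivative_transform_within_open
      [OF has_derivative_frechet[OF assms(4)] assms(1,2)]) (simp add: assms(3))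

lemma differentiable_cong_open:
  assumes "open S" "x \<in> S" "\<And>y. y \<in> S \<Longrightarrow> f y = k y" "k differentiable (at x)"
  shows "f differentiable (at x)"
  using has_derivative_transform_within_open[OF has_derivative_frechet[OF assms(4)] assms(1,2), of f]
    assms(3) by (auto simp: differentiable_def)

lemma differentiable_vec_iff:
  fixes f :: "'a::real_normed_vector \<Rightarrow> real ^ 'n::finite"
  shows "f differentiable (at x) \<longleftrightarrow> (\<forall>i. (\<lambda>y. f y $ i) differentiable (at x))"
proof
  assume "f differentiable (at x)"
  then show "\<forall>i. (\<lambda>y. f y $ i) differentiable (at x)"
    unfolding differentiable_def using bounded_linear.has_derivative[OF bounded_linear_vec_nth] by blast
next
  assume "\<forall>i. (\<lambda>y. f y $ i) differentiable (at x)"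
  then have "(\<lambda>y. \<Sum>i\<in>UNIV. (f y $ i) *\<^sub>R axis i (1::real)) differentiable (at x)"
    by (intro differentiable_sum differentiable_scaleR) auto
  moreover have "(\<lambda>y. \<Sum>i\<in>UNIV. (f y $ i) *\<^sub>R axis i (1::real)) = f"
    using basis_expansion[of "f _"] by (auto simp: scalar_mult_eq_scaleR)
  ultimately show "f differentiable (at x)" by simp
qed

lemma frechet_derivative_nth:
  fixes f :: "'a::real_normed_vector \<Rightarrow> real ^ 'n::finite"
  assumes "f differentiable (at x)"
  shows "frechet_derivative (\<lambda>y. f y $ i) (at x) u = frechet_derivative f (at x) u $ i"
  using frechet_derivative_eqI[OF bounded_linear.has_derivative[OF bounded_linear_vec_nth
        has_derivative_frechet[OF assms]], of i] by simp

text \<open>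
  The product rule for a field \<open>T\<close> of linear maps of which only the values on constant vectors are
  known to be differentiable. In finite dimension this suffices, because \<open>T y (a y)\<close> is a linear
  combination of the values of \<open>T y\<close> on the coordinate vectors.
\<close>

lemma has_derivative_linear_apply:
  fixes T :: "'a::real_normed_vector \<Rightarrow> real ^ 'k::finite \<Rightarrow> 'c::real_normed_vector"
  assumes S: "open S" "x \<in> S" and lin: "\<And>y. y \<in> S \<Longrightarrow> linear (T y)"
    and T: "\<And>v. (\<lambda>y. T y v) differentiable (at x)" and a: "a differentiable (at x)"
  shows "((\<lambda>y. T y (a y)) has_derivative
           (\<lambda>u. frechet_derivative (\<lambda>y. T y (a x)) (at x) u + T x (frechet_derivative a (at x) u))) (at x)"
proof -
  note Td = has_derivative_frechet[OF T] and ad = has_derivative_frechet[OF a]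
  have adi: "((\<lambda>y. a y $ i) has_derivative (\<lambda>u. frechet_derivative a (at x) u $ i)) (at x)" for i
    using bounded_linear.has_derivative[OF bounded_linear_vec_nth ad] .
  let ?D = "\<lambda>u. \<Sum>i\<in>UNIV. (a x $ i) *\<^sub>R frechet_derivative (\<lambda>y. T y (axis i 1)) (at x) u"
  have "((\<lambda>y. \<Sum>i\<in>UNIV. (a x $ i) *\<^sub>R T y (axis i 1)) has_derivative ?D) (at x)"
    by (intro has_derivative_sum has_derivative_scaleR_right Td)
  then have "((\<lambda>y. T y (a x)) has_derivative ?D) (at x)"
    by (rule has_derivative_transform_within_open[OF _ S]) (simp add: linear_expand[OF lin, symmetric])
  then have D: "frechet_derivative (\<lambda>y. T y (a x)) (at x) = ?D" by (rule frechet_derivative_eqI)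
  have "((\<lambda>y. \<Sum>i\<in>UNIV. (a y $ i) *\<^sub>R T y (axis i 1)) has_derivative
      (\<lambda>u. \<Sum>i\<in>UNIV. (a x $ i) *\<^sub>R frechet_derivative (\<lambda>y. T y (axis i 1)) (at x) u
         + (frechet_derivative a (at x) u $ i) *\<^sub>R T x (axis i 1))) (at x)"
    by (intro has_derivative_sum has_derivative_scaleR adi Td)
  then have "((\<lambda>y. T y (a y)) has_derivative
      (\<lambda>u. \<Sum>i\<in>UNIV. (a x $ i) *\<^sub>R frechet_derivative (\<lambda>y. T y (axis i 1)) (at x) u
         + (frechet_derivative a (at x) u $ i) *\<^sub>R T x (axis i 1))) (at x)"
    by (rule has_derivative_transform_within_open[OF _ S]) (simp add: linear_expand[OF lin, symmetric])
  then show ?thesis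
    by (simp add: D sum.distrib linear_expand[OF lin[OF S(2)], symmetric])
qed

lemma differentiable_linear_apply:
  fixes T :: "'a::real_normed_vector \<Rightarrow> real ^ 'k::finite \<Rightarrow> 'c::real_normed_vector"
  assumes "open S" "x \<in> S" "\<And>y. y \<in> S \<Longrightarrow> linear (T y)"
    and "\<And>v. (\<lambda>y. T y v) differentiable (at x)" and "a differentiable (at x)"
  shows "(\<lambda>y. T y (a y)) differentiable (at x)"
  using has_derivative_linear_apply[OF assms] by (auto simp: differentiable_def)

lemma has_derivative_bilinear_apply:
  fixes b :: "'a::real_normed_vector \<Rightarrow> real ^ 'k::finite \<Rightarrow> real ^ 'm::finite \<Rightarrow> 'c::real_normed_vector"
  assumes S: "open S" "x \<in> S" and lin: "\<And>y. y \<in> S \<Longrightarrow> bilinear (b y)"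
    and b: "\<And>v w. (\<lambda>y. b y v w) differentiable (at x)"
    and a: "a differentiable (at x)" and c: "c differentiable (at x)"
  shows "((\<lambda>y. b y (a y) (c y)) has_derivative
           (\<lambda>u. frechet_derivative (\<lambda>y. b y (a x) (c x)) (at x) u
              + b x (frechet_derivative a (at x) u) (c x)
              + b x (a x) (frechet_derivative c (at x) u))) (at x)"
proof -
  have l1: "linear (\<lambda>v. b y v w)" and l2: "linear (b y v)" if "y \<in> S" for y v w
    using lin[OF that] by (auto simp: bilinear_def)
  \<comment> \<open>The product rule for linear maps, once in each argument.\<close>
  have *: "((\<lambda>y. b y (a y) w) has_derivative
      (\<lambda>u. frechet_derivative (\<lambda>y. b y (a x) w) (at x) u
         + b x (frechet_derivative a (at x) u) w)) (at x)" for w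
    by (rule has_derivative_linear_apply[OF S l1 b a])
  then have d: "(\<lambda>y. b y (a y) w) differentiable (at x)" for w
    by (auto simp: differentiable_def)
  show ?thesis
    using has_derivative_linear_apply[OF S l2 d c] by (simp add: frechet_derivative_eqI[OF *])
qed

lemma differentiable_bilinear_apply:
  fixes b :: "'a::real_normed_vector \<Rightarrow> real ^ 'k::finite \<Rightarrow> real ^ 'm::finite \<Rightarrow> 'c::real_normed_vector"
  assumes "open S" "x \<in> S" "\<And>y. y \<in> S \<Longrightarrow> bilinear (b y)"
    and "\<And>v w. (\<lambda>y. b y v w) differentiable (at x)"
    and "a differentiable (at x)" and "c differentiable (at x)"
  shows "(\<lambda>y. b y (a y) (c y)) differentiable (at x)"
  using has_derivative_bilinear_apply[OF assms] by (auto simp: differentiable_def)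

lemma linear_derivative_of_linear_field:
  fixes T :: "'a::real_normed_vector \<Rightarrow> 'd::real_vector \<Rightarrow> 'c::real_normed_vector"
  assumes S: "open S" "x \<in> S" and lin: "\<And>y. y \<in> S \<Longrightarrow> linear (T y)"
    and T: "\<And>v. (\<lambda>y. T y v) differentiable (at x)"
  shows "linear (\<lambda>v. frechet_derivative (\<lambda>y. T y v) (at x) u)"
proof (rule linearI)
  note Td = has_derivative_frechet[OF T]
  show "frechet_derivative (\<lambda>y. T y (v + w)) (at x) u
      = frechet_derivative (\<lambda>y. T y v) (at x) u + frechet_derivative (\<lambda>y. T y w) (at x) u" for v w
    by (rule fun_cong[OF frechet_derivative_eqI, of _ _ _ u],
        rule has_derivative_transform_within_open[OF has_derivative_add[OF Td Td] S])
       (simp add: linear_add[OF lin])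
  show "frechet_derivative (\<lambda>y. T y (r *\<^sub>R v)) (at x) u
      = r *\<^sub>R frechet_derivative (\<lambda>y. T y v) (at x) u" for r v
    by (rule fun_cong[OF frechet_derivative_eqI, of _ _ _ u],
        rule has_derivative_transform_within_open[OF has_derivative_scaleR_right[OF Td] S])
       (simp add: linear_cmul[OF lin])
qed

lemma bilinear_derivative_of_linear_field:
  fixes T :: "'a::real_normed_vector \<Rightarrow> 'd::real_vector \<Rightarrow> 'c::real_normed_vector"
  assumes "open S" "x \<in> S" "\<And>y. y \<in> S \<Longrightarrow> linear (T y)"
    and T: "\<And>v. (\<lambda>y. T y v) differentiable (at x)"
  shows "bilinear (\<lambda>u v. frechet_derivative (\<lambda>y. T y v) (at x) u)"
  unfolding bilinear_def
  using linear_derivative_of_linear_field[OF assms] has_derivative_linear[OF has_derivative_frechet[OF T]]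
  by auto

section \<open>Symmetry of the second derivative\<close>

text \<open>
  The second difference of \<open>f\<close> over the parallelogram spanned by \<open>t u\<close> and \<open>t v\<close> is the increment
  over \<open>[0, t]\<close> of \<open>s \<mapsto> f (x + s u + t v) - f (x + s u)\<close>. The mean value theorem turns it into
  \<open>t\<close> times a difference of two values of \<open>D\<^sub>u f\<close>, and differentiability of \<open>D\<^sub>u f\<close> at the one
  point \<open>x\<close> is enough to evaluate that up to \<open>o(t)\<close>.
\<close>

lemma second_difference_estimate:
  fixes f :: "'a::real_normed_vector \<Rightarrow> real"
  assumes S: "open S" "x \<in> S" and f: "\<And>y. y \<in> S \<Longrightarrow> f differentiable (at y)"
    and L: "((\<lambda>y. frechet_derivative f (at y) u) has_derivative L) (at x)" and "0 < e"
  shows "\<exists>\<delta>>0. \<forall>t. 0 < t \<and> t < \<delta> \<longrightarrow>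
    \<bar>f (x + t *\<^sub>R u + t *\<^sub>R v) - f (x + t *\<^sub>R u) - f (x + t *\<^sub>R v) + f x - t\<^sup>2 * L v\<bar> \<le> e * t\<^sup>2"
proof -
  define C where "C = norm u + norm v + 1"
  have C: "0 < C" "norm u + norm v \<le> C" "norm u \<le> C" unfolding C_def by (auto intro: add_nonneg_pos)
  \<comment> \<open>Two points at distance at most \<open>t C\<close> from \<open>x\<close> contribute an error \<open>e' t C\<close> each, which is then multiplied by \<open>t\<close>.\<close>
  define e' where "e' = e / (2 * C)"
  have e': "0 < e'" using \<open>0 < e\<close> C by (simp add: e'_def)
  let ?D = "\<lambda>y. frechet_derivative f (at y) u"
  obtain d where d: "0 < d"
      "\<And>y. norm (y - x) < d \<Longrightarrow> norm (?D y - ?D x - L (y - x)) \<le> e' * norm (y - x)"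
    using L e' unfolding has_derivative_at_alt by blast
  obtain r where r: "0 < r" "ball x r \<subseteq> S" using S open_contains_ball by blast
  have "\<bar>f (x + t *\<^sub>R u + t *\<^sub>R v) - f (x + t *\<^sub>R u) - f (x + t *\<^sub>R v) + f x - t\<^sup>2 * L v\<bar> \<le> e * t\<^sup>2"
    if t: "0 < t" "t < min d r / C" for t
  proof -
    have tC: "t * C < d" "t * C < r" using t C by (auto simp: pos_less_divide_eq)
    have b: "norm (s *\<^sub>R u + t *\<^sub>R v) \<le> t * C" "norm (s *\<^sub>R u) \<le> t * C" if "0 \<le> s" "s \<le> t" for s
    proof -
      have "norm (s *\<^sub>R u) \<le> t * norm u" using that by (simp add: mult_right_mono)
      moreover have "norm (t *\<^sub>R v) = t * norm v" using t by simp
      moreover have "t * (norm u + norm v) \<le> t * C" "t * norm u \<le> t * C"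
        using C t by (auto intro: mult_left_mono)
      ultimately show "norm (s *\<^sub>R u + t *\<^sub>R v) \<le> t * C" "norm (s *\<^sub>R u) \<le> t * C"
        using norm_triangle_ineq[of "s *\<^sub>R u" "t *\<^sub>R v"] by (auto simp: distrib_left)
    qed
    have inS: "x + s *\<^sub>R u + t *\<^sub>R v \<in> S" "x + s *\<^sub>R u \<in> S" if "0 \<le> s" "s \<le> t" for s
    proof -
      have "dist x (x + w) < r" if "norm w \<le> t * C" for w
        using that tC by (simp add: dist_norm)
      then show "x + s *\<^sub>R u + t *\<^sub>R v \<in> S" "x + s *\<^sub>R u \<in> S"
        using b[OF that] r(2) by (auto simp: add.assoc)
    qed
    define p where "p s = f (x + s *\<^sub>R u + t *\<^sub>R v) - f (x + s *\<^sub>R u)" for s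
    have fd: "((\<lambda>s. f (x + s *\<^sub>R u + w)) has_real_derivative ?D (x + s *\<^sub>R u + w)) (at s)"
      if "x + s *\<^sub>R u + w \<in> S" for s w
    proof -
      have "((\<lambda>s. x + s *\<^sub>R u + w) has_derivative (\<lambda>k. k *\<^sub>R u)) (at s)"
        by (auto intro!: derivative_eq_intros)
      from diff_chain_at[OF this has_derivative_frechet[OF f[OF that]]]
      have "((\<lambda>s. f (x + s *\<^sub>R u + w)) has_derivative
          (\<lambda>k. frechet_derivative f (at (x + s *\<^sub>R u + w)) (k *\<^sub>R u))) (at s)"
        by (simp add: o_def)
      moreover have "(\<lambda>k. frechet_derivative f (at (x + s *\<^sub>R u + w)) (k *\<^sub>R u))
          = (*) (?D (x + s *\<^sub>R u + w))"
        using linear_cmul[OF has_derivative_linear[OF has_derivative_frechet[OF f[OF that]]]]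
        by (auto simp: mult.commute)
      ultimately show ?thesis by (simp add: has_field_derivative_def)
    qed
    have pd: "(p has_real_derivative ?D (x + s *\<^sub>R u + t *\<^sub>R v) - ?D (x + s *\<^sub>R u)) (at s)"
      if "0 \<le> s" "s \<le> t" for s
      unfolding p_def using fd[of s "t *\<^sub>R v"] fd[of s 0] inS[OF that] by (intro DERIV_diff) auto
    obtain s where s: "0 < s" "s < t" and ps: "p t - p 0 = (t - 0) * (?D (x + s *\<^sub>R u + t *\<^sub>R v) - ?D (x + s *\<^sub>R u))"
      using MVT2[OF t(1), of p "\<lambda>s. ?D (x + s *\<^sub>R u + t *\<^sub>R v) - ?D (x + s *\<^sub>R u)", OF pd] by auto
    let ?z = "s *\<^sub>R u + t *\<^sub>R v" and ?w = "s *\<^sub>R u"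
    have near: "\<bar>?D (x + k) - ?D x - L k\<bar> \<le> e' * (t * C)" if "norm k \<le> t * C" for k
    proof -
      have "\<bar>?D (x + k) - ?D x - L k\<bar> \<le> e' * norm k"
        using d(2)[of "x + k"] that tC by simp
      also have "\<dots> \<le> e' * (t * C)" using that e' by (intro mult_left_mono) auto
      finally show ?thesis .
    qed
    have 1: "\<bar>?D (x + ?z) - ?D x - L ?z\<bar> \<le> e' * (t * C)"
      and 2: "\<bar>?D (x + ?w) - ?D x - L ?w\<bar> \<le> e' * (t * C)"
      using b[of s] s by (auto intro!: near)
    have lin: "linear L" using L by (rule has_derivative_linear)
    have "L ?z - L ?w = t * L v" by (simp add: linear_add[OF lin] linear_cmul[OF lin])
    with 1 2 have "\<bar>?D (x + ?z) - ?D (x + ?w) - t * L v\<bar> \<le> 2 * (e' * (t * C))" by linarith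
    then have "\<bar>t * (?D (x + ?z) - ?D (x + ?w) - t * L v)\<bar> \<le> t * (2 * (e' * (t * C)))"
      using t by (simp add: abs_mult)
    also have "\<dots> = e * t\<^sup>2" using C by (simp add: e'_def power2_eq_square)
    finally show ?thesis
      using ps by (simp add: p_def algebra_simps power2_eq_square)
  qed
  then show ?thesis using d(1) r(1) C(1) by (intro exI[of _ "min d r / C"]) auto
qed

text \<open>
  The second difference is symmetric in \<open>u\<close> and \<open>v\<close>, so both mixed derivatives are its limit
  after division by \<open>t\<^sup>2\<close>.
\<close>

lemma second_derivative_symmetric_real:
  fixes f :: "'a::real_normed_vector \<Rightarrow> real"
  assumes S: "open S" "x \<in> S" and f: "\<And>y. y \<in> S \<Longrightarrow> f differentiable (at y)"
    and f2: "\<And>u. (\<lambda>y. frechet_derivative f (at y) u) differentiable (at x)"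
  shows "frechet_derivative (\<lambda>y. frechet_derivative f (at y) u) (at x) v
       = frechet_derivative (\<lambda>y. frechet_derivative f (at y) v) (at x) u" (is "?a = ?b")
proof -
  have "\<bar>?a - ?b\<bar> \<le> e" if e: "0 < e" for e
  proof -
    note h = second_difference_estimate[OF S f has_derivative_frechet[OF f2], of "e / 2"]
    obtain d1 where d1: "d1 > 0" "\<And>t. 0 < t \<Longrightarrow> t < d1 \<Longrightarrow>
      \<bar>f (x + t *\<^sub>R u + t *\<^sub>R v) - f (x + t *\<^sub>R u) - f (x + t *\<^sub>R v) + f x - t\<^sup>2 * ?a\<bar> \<le> e / 2 * t\<^sup>2"
      using h[of u v] e by auto
    obtain d2 where d2: "d2 > 0" "\<And>t. 0 < t \<Longrightarrow> t < d2 \<Longrightarrow>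
      \<bar>f (x + t *\<^sub>R v + t *\<^sub>R u) - f (x + t *\<^sub>R v) - f (x + t *\<^sub>R u) + f x - t\<^sup>2 * ?b\<bar> \<le> e / 2 * t\<^sup>2"
      using h[of v u] e by auto
    define t where "t = min d1 d2 / 2"
    have t: "0 < t" "t < d1" "t < d2" using d1(1) d2(1) by (auto simp: t_def)
    have c: "x + t *\<^sub>R v + t *\<^sub>R u = x + t *\<^sub>R u + t *\<^sub>R v" by simp
    have "\<bar>t\<^sup>2 * ?a - t\<^sup>2 * ?b\<bar> \<le> e * t\<^sup>2"
      using d1(2)[OF t(1,2)] d2(2)[OF t(1,3)] unfolding c by linarith
    also have "\<bar>t\<^sup>2 * ?a - t\<^sup>2 * ?b\<bar> = \<bar>?a - ?b\<bar> * t\<^sup>2"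
      by (simp add: right_diff_distrib[symmetric] abs_mult)
    finally show ?thesis using t by simp
  qed
  from this[of "\<bar>?a - ?b\<bar> / 2"] show ?thesis by fastforce
qed

lemma second_derivative_symmetric:
  fixes f :: "'a::real_normed_vector \<Rightarrow> real ^ 'n::finite"
  assumes S: "open S" "x \<in> S" and f: "\<And>y. y \<in> S \<Longrightarrow> f differentiable (at y)"
    and f2: "\<And>u. (\<lambda>y. frechet_derivative f (at y) u) differentiable (at x)"
  shows "frechet_derivative (\<lambda>y. frechet_derivative f (at y) u) (at x) v
       = frechet_derivative (\<lambda>y. frechet_derivative f (at y) v) (at x) u"
proof (rule vec_eq_iff[THEN iffD2], rule allI)
  fix i
  have fi: "(\<lambda>y. f y $ i) differentiable (at y)" if "y \<in> S" for y
    using f[OF that] by (simp add: differentiable_vec_iff)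
  have di: "(\<lambda>y. frechet_derivative f (at y) u $ i) differentiable (at x)" for u
    using f2[of u] by (simp add: differentiable_vec_iff)
  have eq: "frechet_derivative (\<lambda>z. f z $ i) (at y) u = frechet_derivative f (at y) u $ i"
    if "y \<in> S" for y u
    by (rule frechet_derivative_nth[OF f[OF that]])
  have d2: "(\<lambda>y. frechet_derivative (\<lambda>z. f z $ i) (at y) u) differentiable (at x)" for u
    by (rule differentiable_cong_open[OF S eq di])
  have e2: "frechet_derivative (\<lambda>y. frechet_derivative (\<lambda>z. f z $ i) (at y) u) (at x) v
      = frechet_derivative (\<lambda>y. frechet_derivative f (at y) u) (at x) v $ i" for u v
    using frechet_derivative_cong_open[OF S eq di, of u] frechet_derivative_nth[OF f2, of u i v] by simp
  show "frechet_derivative (\<lambda>y. frechet_derivative f (at y) u) (at x) v $ i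
      = frechet_derivative (\<lambda>y. frechet_derivative f (at y) v) (at x) u $ i"
    using second_derivative_symmetric_real[OF S fi d2, of u v] by (simp add: e2)
qed

section \<open>Fields given by their products with arbitrary vectors\<close>

lemma differentiable_prod:
  fixes f :: "'i \<Rightarrow> 'a::real_normed_vector \<Rightarrow> real"
  assumes "\<And>i. i \<in> I \<Longrightarrow> f i differentiable (at x)"
  shows "(\<lambda>y. \<Prod>i\<in>I. f i y) differentiable (at x)"
  using assms by (induction I rule: infinite_finite_induct) auto

lemma differentiable_det:
  fixes A :: "'a::real_normed_vector \<Rightarrow> real ^ 'n::finite ^ 'n"
  assumes "\<And>i j. (\<lambda>y. A y $ i $ j) differentiable (at x)"
  shows "(\<lambda>y. det (A y)) differentiable (at x)"
  unfolding det_def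
  by (intro differentiable_sum differentiable_mult differentiable_const ballI differentiable_prod assms)
     (auto simp: finite_permutations)

text \<open>
  The components of \<open>a\<close> solve a linear system whose matrix is the Gram matrix of \<open>g\<close>. Cramer's rule
  writes them as quotients of determinants, hence as rational functions of differentiable ones.
\<close>

lemma differentiable_riesz:
  fixes g :: "'a::real_normed_vector \<Rightarrow> real ^ 'n::finite \<Rightarrow> real ^ 'n \<Rightarrow> real"
  assumes S: "open S" "x \<in> S" and I: "\<And>y. y \<in> S \<Longrightarrow> inner_form (g y)"
    and g: "\<And>v w. (\<lambda>y. g y v w) differentiable (at x)"
    and L: "\<And>w. (\<lambda>y. L y w) differentiable (at x)"
    and a: "\<And>y w. y \<in> S \<Longrightarrow> g y (a y) w = L y w"
  shows "a differentiable (at x)"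
proof -
  \<comment> \<open>\<open>G\<close> is the Gram matrix, and \<open>N y k\<close> the numerator matrix of Cramer's rule.\<close>
  define G where "G y = (\<chi> j i. g y (axis i 1) (axis j 1))" for y
  define l where "l y = (\<chi> j. L y (axis j 1))" for y
  define N where "N y k = (\<chi> i j. if j = k then l y $ i else G y $ i $ j)" for y and k :: 'n
  have Gv: "(G y *v v) $ j = g y v (axis j 1)" if "y \<in> S" for y v j
  proof -
    have "linear (\<lambda>v. g y v (axis j 1))" using inner_form_bilinear[OF I[OF that]] by (simp add: bilinear_def)
    from linear_expand[OF this, of v] show ?thesis
      by (simp add: G_def matrix_vector_mult_def mult.commute)
  qed
  have det: "det (G y) \<noteq> 0" if y: "y \<in> S" for y
  proof -
    have "v = 0" if "G y *v v = 0" for v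
    proof (rule ccontr)
      assume "v \<noteq> 0"
      then have p: "0 < g y v v" using I[OF y] by (simp add: inner_form_def)
      have "linear (g y v)" using inner_form_bilinear[OF I[OF y]] by (simp add: bilinear_def)
      from linear_expand[OF this, of v] have "g y v v = 0"
        using that by (simp add: Gv[OF y, symmetric])
      with p show False by simp
    qed
    then show ?thesis
      by (metis invertible_det_nz invertible_left_inverse matrix_left_invertible_ker)
  qed
  have Na: "a y = (\<chi> k. det (N y k) / det (G y))" if y: "y \<in> S" for y
  proof -
    have "G y *v a y = l y" by (simp add: vec_eq_iff Gv[OF y] a[OF y] l_def)
    then show ?thesis unfolding N_def using cramer[OF det[OF y]] by blast
  qed
  have dG: "(\<lambda>y. G y $ i $ j) differentiable (at x)" for i j by (simp add: G_def g)
  have dN: "(\<lambda>y. N y k $ i $ j) differentiable (at x)" for i j k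
    using dG[of i j] L by (cases "j = k") (simp_all add: N_def l_def)
  have "(\<lambda>y. det (N y k) / det (G y)) differentiable (at x)" for k
    by (rule differentiable_divide[OF differentiable_det[OF dN] differentiable_det[OF dG] det[OF S(2)]])
  then have "(\<lambda>y. \<chi> k. det (N y k) / det (G y)) differentiable (at x)"
    by (simp add: differentiable_vec_iff)
  from differentiable_cong_open[OF S Na this] show ?thesis .
qed

section \<open>The Levi-Civita connection and the metric trace\<close>

lemma smooth_on_differentiable: "smooth_on S f \<Longrightarrow> x \<in> S \<Longrightarrow> f differentiable (at x)"
  unfolding smooth_on_def by (metis C_on.simps(2))

lemma smooth_on_frechet_derivative:
  "smooth_on S f \<Longrightarrow> smooth_on S (\<lambda>y. frechet_derivative f (at y) v)"
  unfolding smooth_on_def by (metis C_on.simps(2))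

lemma riemannian_metric_inner_form: "riemannian_metric_on S g \<Longrightarrow> x \<in> S \<Longrightarrow> inner_form (g x)"
  by (simp add: riemannian_metric_on_def)

lemma riemannian_metric_smooth: "riemannian_metric_on S g \<Longrightarrow> smooth_on S (\<lambda>x. g x u v)"
  by (simp add: riemannian_metric_on_def)

lemma C_on_subset: "C_on k S f \<Longrightarrow> S' \<subseteq> S \<Longrightarrow> C_on k S' f"
  by (induction k arbitrary: f) (auto intro: continuous_on_subset)

lemma riemannian_metric_on_subset:
  "riemannian_metric_on S g \<Longrightarrow> S' \<subseteq> S \<Longrightarrow> riemannian_metric_on S' g"
  unfolding riemannian_metric_on_def smooth_on_def using C_on_subset by blast

lemma bilinear_levi_civita:
  "open S \<Longrightarrow> x \<in> S \<Longrightarrow> riemannian_metric_on S g \<Longrightarrow> bilinear (levi_civita g x)"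
  using levi_civita_levi_civita_at unfolding levi_civita_at_def by blast

text \<open>
  The Koszul formula for constant vector fields, whose Lie brackets vanish. Its right-hand side
  consists of derivatives of the metric, which makes the connection differentiable.
\<close>

lemma koszul_formula:
  assumes S: "open S" "x \<in> S" and g: "riemannian_metric_on S g"
  shows "g x (levi_civita g x u v) w =
    (frechet_derivative (\<lambda>y. g y v w) (at x) u + frechet_derivative (\<lambda>y. g y u w) (at x) v
      - frechet_derivative (\<lambda>y. g y u v) (at x) w) / 2"
proof -
  have lc: "levi_civita g x a b = levi_civita g x b a"
    "frechet_derivative (\<lambda>y. g y b c) (at x) a
      = g x (levi_civita g x a b) c + g x b (levi_civita g x a c)" for a b c
    using levi_civita_levi_civita_at[OF S g] unfolding levi_civita_at_def by blast+
  have sym: "g x a b = g x b a" for a b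
    using riemannian_metric_inner_form[OF g S(2)] by (simp add: inner_form_def)
  show ?thesis
    unfolding lc(2) using lc(1)[of u v] lc(1)[of u w] lc(1)[of v w]
      sym[of v "levi_civita g x u w"] sym[of u "levi_civita g x v w"] sym[of u "levi_civita g x w v"]
    by simp
qed

lemma differentiable_levi_civita:
  assumes S: "open S" "x \<in> S" and g: "riemannian_metric_on S g"
  shows "(\<lambda>y. levi_civita g y u v) differentiable (at x)"
proof (rule differentiable_riesz[OF S, where g = g and L = "\<lambda>y w.
    (frechet_derivative (\<lambda>y. g y v w) (at y) u + frechet_derivative (\<lambda>y. g y u w) (at y) v
      - frechet_derivative (\<lambda>y. g y u v) (at y) w) / 2"])
  show "(\<lambda>y. (frechet_derivative (\<lambda>y. g y v w) (at y) u + frechet_derivative (\<lambda>y. g y u w) (at y) v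
      - frechet_derivative (\<lambda>y. g y u v) (at y) w) / 2) differentiable (at x)" for w
    by (intro differentiable_divide differentiable_add differentiable_diff differentiable_const
        smooth_on_differentiable[OF smooth_on_frechet_derivative S(2)] riemannian_metric_smooth[OF g]) simp
  show "(\<lambda>y. g y v w) differentiable (at x)" for v w
    by (rule smooth_on_differentiable[OF riemannian_metric_smooth[OF g] S(2)])
qed (use g S koszul_formula riemannian_metric_inner_form in blast)+

text \<open>
  In coordinates the trace is \<open>\<Sum> g\<^sup>i\<^sup>j b\<^sub>i\<^sub>j\<close>; the vector \<open>R i\<close> is the \<open>i\<close>-th coordinate form with its
  index raised. Unlike an arbitrarily chosen orthonormal basis, \<open>R i\<close> depends differentiably on the
  point, so that this expression can be differentiated.
\<close>

lemma metric_trace_dual_basis: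
  fixes g :: "('n::finite) form_field"
  assumes g: "inner_form (g x)" and b: "bilinear b" and R: "\<And>i w. g x (R i) w = w $ i"
  shows "metric_trace g x b = (\<Sum>i\<in>UNIV. b (axis i 1) (R i))"
proof -
  obtain X where X: "orthonormal_at g x X" using orthonormal_exists[of g x, OF g] by blast
  have e: "(\<Sum>k\<in>UNIV. (X k $ i) *\<^sub>R X k) = R i" for i
    using orthonormal_expand[of g x, OF g X, of "R i"] by (simp add: R)
  have b1: "linear (\<lambda>u. b u w)" for w using b by (simp add: bilinear_def)
  have "b (X k) (X k) = (\<Sum>i\<in>UNIV. (X k $ i) *\<^sub>R b (axis i 1) (X k))" for k
    by (rule linear_expand[OF b1])
  then have "metric_trace g x b = (\<Sum>k\<in>UNIV. \<Sum>i\<in>UNIV. (X k $ i) *\<^sub>R b (axis i 1) (X k))"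
    by (simp add: metric_trace_eq[of g x, OF g X b])
  also have "\<dots> = (\<Sum>i\<in>UNIV. b (axis i 1) (\<Sum>k\<in>UNIV. (X k $ i) *\<^sub>R X k))"
    by (subst sum.swap) (simp add: bilinear_sum_right[OF b])
  also have "\<dots> = (\<Sum>i\<in>UNIV. b (axis i 1) (R i))" by (simp add: e)
  finally show ?thesis .
qed

lemma differentiable_metric_trace:
  fixes b :: "real ^ 'm::finite \<Rightarrow> real ^ 'm \<Rightarrow> real ^ 'm \<Rightarrow> 'c::real_normed_vector"
  assumes S: "open S" "x \<in> S" and g: "riemannian_metric_on S g"
    and b: "\<And>y. y \<in> S \<Longrightarrow> bilinear (b y)" and bd: "\<And>u v. (\<lambda>y. b y u v) differentiable (at x)"
  shows "(\<lambda>y. metric_trace g y (b y)) differentiable (at x)"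
proof -
  define R where "R y i = (THE a. \<forall>w. g y a w = w $ i)" for y i
  have R: "g y (R y i) w = w $ i" if "y \<in> S" for y i w
  proof -
    have "linear (\<lambda>w::real ^ 'm. w $ i)" using bounded_linear_vec_nth by (rule bounded_linear.linear)
    from theI'[OF inner_form_riesz[OF riemannian_metric_inner_form[OF g that] this]]
    show ?thesis by (simp add: R_def)
  qed
  have Rd: "(\<lambda>y. R y i) differentiable (at x)" for i
    by (rule differentiable_riesz[OF S, where g = g and L = "\<lambda>y w. w $ i"])
       (simp_all add: R riemannian_metric_inner_form[OF g] smooth_on_differentiable[OF riemannian_metric_smooth[OF g] S(2)])
  have bl: "linear (b y v)" if "y \<in> S" for y v using b[OF that] by (simp add: bilinear_def)
  have "(\<lambda>y. b y (axis i 1) (R y i)) differentiable (at x)" for i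
    by (rule differentiable_linear_apply[OF S bl bd Rd])
  then have sd: "(\<lambda>y. \<Sum>i\<in>UNIV. b y (axis i 1) (R y i)) differentiable (at x)" by simp
  have "metric_trace g y (b y) = (\<Sum>i\<in>UNIV. b y (axis i 1) (R y i))" if "y \<in> S" for y
    by (rule metric_trace_dual_basis[of g y, OF riemannian_metric_inner_form[OF g that] b[OF that] R[OF that]])
  from differentiable_cong_open[OF S this sd] show ?thesis .
qed

section \<open>Covariant derivatives of endomorphism fields\<close>

lemma differentiable_metric:
  assumes S: "open S" "x \<in> S" and g: "riemannian_metric_on S g"
    and a: "a differentiable (at x)" and c: "c differentiable (at x)"
  shows "(\<lambda>y. g y (a y) (c y)) differentiable (at x)"
proof -
  have bl: "bilinear (g y)" if "y \<in> S" for y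
    using inner_form_bilinear[OF riemannian_metric_inner_form[OF g that]] .
  have gd: "(\<lambda>y. g y v w) differentiable (at x)" for v w
    by (rule smooth_on_differentiable[OF riemannian_metric_smooth[OF g] S(2)])
  show ?thesis by (rule differentiable_bilinear_apply[OF S bl gd a c])
qed

text \<open>
  Compatibility of the connection with the metric, extended from constant to arbitrary
  differentiable vector fields by the product rule.
\<close>

lemma frechet_derivative_metric:
  assumes S: "open S" "x \<in> S" and g: "riemannian_metric_on S g"
    and a: "a differentiable (at x)" and c: "c differentiable (at x)"
  shows "frechet_derivative (\<lambda>y. g y (a y) (c y)) (at x) u
    = g x (nabla g a x u) (c x) + g x (a x) (nabla g c x u)"
proof -
  have bl: "bilinear (g y)" if "y \<in> S" for y
    using inner_form_bilinear[OF riemannian_metric_inner_form[OF g that]] .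
  have gd: "(\<lambda>y. g y v w) differentiable (at x)" for v w
    by (rule smooth_on_differentiable[OF riemannian_metric_smooth[OF g] S(2)])
  have lc: "frechet_derivative (\<lambda>y. g y v w) (at x) u
      = g x (levi_civita g x u v) w + g x v (levi_civita g x u w)" for v w
    using levi_civita_levi_civita_at[OF S g] unfolding levi_civita_at_def by blast
  show ?thesis
    using frechet_derivative_eqI[OF has_derivative_bilinear_apply[OF S bl gd a c]]
    by (simp add: nabla_def lc bilinear_ladd[OF bl[OF S(2)]] bilinear_radd[OF bl[OF S(2)]])
qed

lemma nabla_const: "nabla g (\<lambda>_. v) x u = levi_civita g x u v"
  by (simp add: nabla_def)

lemma nabla_tensor_eq:
  "nabla_tensor g A x u v
    = frechet_derivative (\<lambda>y. A y v) (at x) u + levi_civita g x u (A x v) - A x (levi_civita g x u v)"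
  by (simp add: nabla_tensor_def nabla_def)

lemma bilinear_nabla_tensor:
  fixes A :: "real ^ 'm::finite \<Rightarrow> real ^ 'm \<Rightarrow> real ^ 'm"
  assumes S: "open S" "x \<in> S" and g: "riemannian_metric_on S g"
    and lin: "\<And>y. y \<in> S \<Longrightarrow> linear (A y)" and d: "\<And>v. (\<lambda>y. A y v) differentiable (at x)"
  shows "bilinear (nabla_tensor g A x)"
proof -
  note D = bilinear_derivative_of_linear_field[OF S lin d]
  note G = bilinear_levi_civita[OF S g] and lx = lin[OF S(2)]
  show ?thesis
    unfolding bilinear_def nabla_tensor_eq
    by (intro conjI allI linearI)
       (simp_all add: bilinear_ladd[OF D] bilinear_radd[OF D] bilinear_lmul[OF D] bilinear_rmul[OF D]
         bilinear_ladd[OF G] bilinear_radd[OF G] bilinear_lmul[OF G] bilinear_rmul[OF G]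
         linear_add[OF lx] linear_cmul[OF lx] algebra_simps)
qed

lemma nabla_tensor_self_adjoint:
  assumes S: "open S" "x \<in> S" and g: "riemannian_metric_on S g"
    and d: "\<And>v. (\<lambda>y. A y v) differentiable (at x)"
    and sa: "\<And>y v w. y \<in> S \<Longrightarrow> g y (A y v) w = g y v (A y w)"
  shows "g x (nabla_tensor g A x u v) w = g x v (nabla_tensor g A x u w)"
proof -
  have bl: "bilinear (g x)"
    using inner_form_bilinear[OF riemannian_metric_inner_form[OF g S(2)]] .
  have d1: "frechet_derivative (\<lambda>y. g y (A y v) w) (at x) u
      = g x (nabla g (\<lambda>y. A y v) x u) w + g x (A x v) (levi_civita g x u w)"
    using frechet_derivative_metric[OF S g d differentiable_const, of v w u] by (simp add: nabla_const)
  have d2: "frechet_derivative (\<lambda>y. g y v (A y w)) (at x) u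
      = g x (levi_civita g x u v) (A x w) + g x v (nabla g (\<lambda>y. A y w) x u)"
    using frechet_derivative_metric[OF S g differentiable_const d, of v w u] by (simp add: nabla_const)
  have "(\<lambda>y. g y v (A y w)) differentiable (at x)"
    by (rule differentiable_metric[OF S g differentiable_const d])
  from frechet_derivative_cong_open[OF S sa this]
  have "frechet_derivative (\<lambda>y. g y (A y v) w) (at x) u = frechet_derivative (\<lambda>y. g y v (A y w)) (at x) u"
    by simp
  then show ?thesis
    unfolding d1 d2 by (simp add: nabla_tensor_def nabla_const bilinear_lsub[OF bl] bilinear_rsub[OF bl] sa[OF S(2)])
qed

text \<open>
  For self-adjoint \<open>A\<close>, hypothesis \<open>q\<close> is the equation \<open>A\<^sup>2 = p A - q I\<close> with constant coefficients, and
  the conclusion is its covariant derivative \<open>A (\<nabla>\<^sub>u A) + (\<nabla>\<^sub>u A) A = p \<nabla>\<^sub>u A\<close>. Both are stated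
  through the metric, so that compatibility of the connection with the metric is the only
  differentiation rule involved.
\<close>

lemma nabla_tensor_quadratic:
  assumes S: "open S" "x \<in> S" and g: "riemannian_metric_on S g"
    and d: "\<And>v. (\<lambda>y. A y v) differentiable (at x)"
    and sa: "\<And>y v w. y \<in> S \<Longrightarrow> g y (A y v) w = g y v (A y w)"
    and q: "\<And>y v w. y \<in> S \<Longrightarrow> g y (A y v) (A y w) = p * g y (A y v) w - q * g y v w"
  shows "g x (nabla_tensor g A x u v) (A x w) + g x (A x v) (nabla_tensor g A x u w)
       = p * g x (nabla_tensor g A x u v) w"
proof -
  have bl: "bilinear (g x)"
    using inner_form_bilinear[OF riemannian_metric_inner_form[OF g S(2)]] .
  note gd = differentiable_metric[OF S g]
  note gAA = gd[OF d d] and gA = gd[OF d differentiable_const] and gc = gd[OF differentiable_const differentiable_const]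
  let ?N = "\<lambda>v. nabla_tensor g A x u v" and ?G = "levi_civita g x u"
  have nA: "nabla g (\<lambda>y. A y v) x u = ?N v + A x (?G v)" for v
    by (simp add: nabla_tensor_def nabla_const)
  have "frechet_derivative (\<lambda>y. g y (A y v) (A y w)) (at x)
      = frechet_derivative (\<lambda>y. p * g y (A y v) w - q * g y v w) (at x)"
    by (rule frechet_derivative_cong_open[OF S q])
       (assumption, intro differentiable_diff differentiable_mult gA gc differentiable_const)
  also have "\<dots> = (\<lambda>u. p * frechet_derivative (\<lambda>y. g y (A y v) w) (at x) u
      - q * frechet_derivative (\<lambda>y. g y v w) (at x) u)"
    by (rule frechet_derivative_eqI)
       (intro has_derivative_diff has_derivative_mult_right has_derivative_frechet[OF gA] has_derivative_frechet[OF gc])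
  finally have "frechet_derivative (\<lambda>y. g y (A y v) (A y w)) (at x) u
      = p * frechet_derivative (\<lambda>y. g y (A y v) w) (at x) u - q * frechet_derivative (\<lambda>y. g y v w) (at x) u"
    by simp
  \<comment> \<open>The terms with \<open>\<Gamma>(u, v)\<close> or \<open>\<Gamma>(u, w)\<close> cancel by the hypothesis at \<open>x\<close>.\<close>
  then have "g x (?N v + A x (?G v)) (A x w) + g x (A x v) (?N w + A x (?G w))
      = p * (g x (?N v + A x (?G v)) w + g x (A x v) (?G w)) - q * (g x (?G v) w + g x v (?G w))"
    using frechet_derivative_metric[OF S g d d, of v w u]
      frechet_derivative_metric[OF S g d differentiable_const, of v w u]
      frechet_derivative_metric[OF S g differentiable_const differentiable_const, of v w u]
    by (simp add: nA nabla_const)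
  then show ?thesis
    by (simp add: bilinear_ladd[OF bl] bilinear_radd[OF bl] q[OF S(2)] algebra_simps)
qed

section \<open>The second fundamental form and the shape operators\<close>

text \<open>
  A smooth map read in a pair of charts. The constructions for a Riemannian immersion are treated
  here for the coordinate expressions of the two metrics and of the map.
\<close>

locale local_map =
  fixes g :: "('m::finite) form_field" and h :: "('n::finite) form_field"
    and F :: "real ^ 'm \<Rightarrow> real ^ 'n" and S :: "(real ^ 'm) set" and T :: "(real ^ 'n) set"
  assumes open_dom: "open S" and open_cod: "open T"
    and metric_dom: "riemannian_metric_on S g" and metric_cod: "riemannian_metric_on T h"
    and maps_into: "x \<in> S \<Longrightarrow> F x \<in> T" and smooth: "smooth_on S F"
begin

abbreviation "B \<equiv> second_fundamental_form g h F"

lemma inner_dom: "x \<in> S \<Longrightarrow> inner_form (g x)"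
  by (rule riemannian_metric_inner_form[OF metric_dom])

lemma inner_cod: "x \<in> S \<Longrightarrow> inner_form (h (F x))"
  by (rule riemannian_metric_inner_form[OF metric_cod maps_into])

lemma differentiable_map: "x \<in> S \<Longrightarrow> F differentiable (at x)"
  by (rule smooth_on_differentiable[OF smooth])

lemma linear_derivative: "x \<in> S \<Longrightarrow> linear (frechet_derivative F (at x))"
  by (rule has_derivative_linear[OF has_derivative_frechet[OF differentiable_map]])

lemma differentiable_derivative:
  "x \<in> S \<Longrightarrow> (\<lambda>y. frechet_derivative F (at y) v) differentiable (at x)"
  by (rule smooth_on_differentiable[OF smooth_on_frechet_derivative[OF smooth]])

lemma differentiable_pullback:
  fixes b :: "real ^ 'n \<Rightarrow> 'c::real_normed_vector"
  assumes "x \<in> S" and "b differentiable (at (F x))"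
  shows "(\<lambda>y. b (F y)) differentiable (at x)"
  using differentiable_chain_at[OF differentiable_map[OF assms(1)] assms(2)] by (simp add: o_def)

lemma second_fundamental_form_eq:
  "B x u v = frechet_derivative (\<lambda>y. frechet_derivative F (at y) v) (at x) u
    + levi_civita h (F x) (frechet_derivative F (at x) u) (frechet_derivative F (at x) v)
    - frechet_derivative F (at x) (levi_civita g x u v)"
  by (simp add: second_fundamental_form_def nabla_along_def nabla_const)

text \<open>
  Both connections are torsion free and second derivatives commute.
\<close>

lemma second_fundamental_form_symmetric:
  assumes x: "x \<in> S"
  shows "B x u v = B x v u"
proof -
  have "frechet_derivative (\<lambda>y. frechet_derivative F (at y) v) (at x) u
      = frechet_derivative (\<lambda>y. frechet_derivative F (at y) u) (at x) v"
    by (rule second_derivative_symmetric[OF open_dom x differentiable_map differentiable_derivative[OF x]])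
  moreover have "levi_civita g x u v = levi_civita g x v u"
    using levi_civita_levi_civita_at[OF open_dom x metric_dom] unfolding levi_civita_at_def by blast
  moreover have "levi_civita h (F x) u' v' = levi_civita h (F x) v' u'" for u' v'
    using levi_civita_levi_civita_at[OF open_cod maps_into[OF x] metric_cod]
    unfolding levi_civita_at_def by blast
  ultimately show ?thesis by (simp add: second_fundamental_form_eq)
qed

lemma bilinear_second_fundamental_form:
  assumes x: "x \<in> S"
  shows "bilinear (B x)"
proof -
  note D = bilinear_derivative_of_linear_field
    [OF open_dom x linear_derivative differentiable_derivative[OF x]]
  note G = bilinear_levi_civita[OF open_dom x metric_dom]
    and K = bilinear_levi_civita[OF open_cod maps_into[OF x] metric_cod]
  note L = linear_derivative[OF x]
  have "linear (B x u)" for u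
    unfolding second_fundamental_form_eq
    by (intro linearI)
       (simp_all add: bilinear_radd[OF D] bilinear_rmul[OF D] bilinear_radd[OF G] bilinear_rmul[OF G]
         bilinear_radd[OF K] bilinear_rmul[OF K] linear_add[OF L] linear_cmul[OF L] algebra_simps)
  moreover have "(\<lambda>u. B x u v) = B x v" for v
    using second_fundamental_form_symmetric[OF x] by blast
  ultimately show ?thesis by (simp add: bilinear_def)
qed

lemma differentiable_second_fundamental_form:
  assumes x: "x \<in> S"
  shows "(\<lambda>y. B y u v) differentiable (at x)"
proof -
  have "(\<lambda>y. frechet_derivative (\<lambda>z. frechet_derivative F (at z) v) (at y) u) differentiable (at x)"
    by (rule smooth_on_differentiable[OF _ x]) (intro smooth_on_frechet_derivative smooth)
  moreover have "(\<lambda>y. levi_civita h (F y) (frechet_derivative F (at y) u) (frechet_derivative F (at y) v))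
      differentiable (at x)"
    by (rule differentiable_bilinear_apply[OF open_dom x
          bilinear_levi_civita[OF open_cod maps_into metric_cod]
          differentiable_pullback[OF x differentiable_levi_civita[OF open_cod maps_into[OF x] metric_cod]]
          differentiable_derivative[OF x] differentiable_derivative[OF x]])
  moreover have "(\<lambda>y. frechet_derivative F (at y) (levi_civita g y u v)) differentiable (at x)"
    by (rule differentiable_linear_apply[OF open_dom x linear_derivative
          differentiable_derivative[OF x] differentiable_levi_civita[OF open_dom x metric_dom]])
  ultimately show ?thesis
    unfolding second_fundamental_form_eq by (intro differentiable_add differentiable_diff)
qed

lemma differentiable_inner_along:
  assumes x: "x \<in> S" and "a differentiable (at x)" and "c differentiable (at x)"
  shows "(\<lambda>y. h (F y) (a y) (c y)) differentiable (at x)"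
  by (rule differentiable_bilinear_apply[OF open_dom x inner_form_bilinear[OF inner_cod]
        differentiable_pullback[OF x smooth_on_differentiable[OF riemannian_metric_smooth[OF metric_cod]
            maps_into[OF x]]] assms(2,3)])

lemma shape_operator_eq:
  assumes x: "x \<in> S"
  shows "g x (shape_operator g h F x \<eta> u) v = h (F x) (B x u v) \<eta>"
proof -
  have "linear (\<lambda>v. h (F x) (B x u v) \<eta>)" for u
    using inner_form_bilinear[OF inner_cod[OF x]] bilinear_second_fundamental_form[OF x]
    by (intro linearI) (simp_all add: bilinear_ladd bilinear_radd bilinear_lmul bilinear_rmul)
  from theI'[OF inner_form_representation[OF inner_dom[OF x] this]]
  show ?thesis by (simp add: shape_operator_def)
qed

lemma shape_operator_self_adjoint:
  assumes x: "x \<in> S"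
  shows "g x (shape_operator g h F x \<eta> u) v = g x u (shape_operator g h F x \<eta> v)"
proof -
  have "g x u (shape_operator g h F x \<eta> v) = g x (shape_operator g h F x \<eta> v) u"
    using inner_dom[OF x] by (simp add: inner_form_def)
  then show ?thesis
    by (simp add: shape_operator_eq[OF x] second_fundamental_form_symmetric[OF x, of u v])
qed

lemma linear_shape_operator:
  assumes x: "x \<in> S"
  shows "linear (shape_operator g h F x \<eta>)"
proof -
  note bl = inner_form_bilinear[OF inner_dom[OF x]]
    inner_form_bilinear[OF inner_cod[OF x]] bilinear_second_fundamental_form[OF x]
  show ?thesis
    by (rule linearI; rule inner_form_eqI[OF inner_dom[OF x]])
       (simp_all add: shape_operator_eq[OF x] bl[THEN bilinear_ladd] bl[THEN bilinear_lmul])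
qed

text \<open>
  The normal field \<open>\<eta>\<close> may vary with the point, since the shape operator is to be taken in the
  direction of the mean curvature field.
\<close>

lemma differentiable_shape_operator:
  assumes x: "x \<in> S" and \<eta>: "\<eta> differentiable (at x)"
  shows "(\<lambda>y. shape_operator g h F y (\<eta> y) u) differentiable (at x)"
proof (rule differentiable_riesz[OF open_dom x, where g = g and L = "\<lambda>y w. h (F y) (B y u w) (\<eta> y)"])
  show "(\<lambda>y. g y v w) differentiable (at x)" for v w
    by (rule smooth_on_differentiable[OF riemannian_metric_smooth[OF metric_dom] x])
  show "(\<lambda>y. h (F y) (B y u w) (\<eta> y)) differentiable (at x)" for w
    by (rule differentiable_inner_along[OF x differentiable_second_fundamental_form[OF x] \<eta>])
qed (simp_all add: inner_dom shape_operator_eq)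

lemma trace_shape_operator:
  assumes x: "x \<in> S" and X: "orthonormal_at g x X"
  shows "(\<Sum>i\<in>UNIV. g x (shape_operator g h F x \<eta> (X i)) (X i)) = h (F x) (metric_trace g x (B x)) \<eta>"
proof -
  have "linear (\<lambda>w. h (F x) w \<eta>)"
    using inner_form_bilinear[OF inner_cod[OF x]] by (simp add: bilinear_def)
  then show ?thesis
    by (simp add: shape_operator_eq[OF x] linear_sum[of "\<lambda>w. h (F x) w \<eta>"]
        metric_trace_eq[of g x, OF inner_dom[OF x] X bilinear_second_fundamental_form[OF x]])
qed

end

section \<open>The mean curvature direction of a surface\<close>

locale local_surface = local_map g h F S T
  for g :: "2 form_field" and h :: "('n::finite) form_field" and F S T
begin

abbreviation "H \<equiv> mean_curvature g h F"
abbreviation "A \<equiv> shape_H g h F"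

lemma differentiable_mean_curvature: "x \<in> S \<Longrightarrow> H differentiable (at x)"
  unfolding mean_curvature_def[abs_def]
  by (intro differentiable_scaleR differentiable_const differentiable_metric_trace[OF open_dom _ metric_dom]
      bilinear_second_fundamental_form differentiable_second_fundamental_form)

lemma differentiable_shape_H: "x \<in> S \<Longrightarrow> (\<lambda>y. A y v) differentiable (at x)"
  unfolding shape_H_def by (rule differentiable_shape_operator[OF _ differentiable_mean_curvature])

lemma linear_shape_H: "x \<in> S \<Longrightarrow> linear (A x)"
  unfolding shape_H_def by (rule linear_shape_operator)

lemma shape_H_self_adjoint: "x \<in> S \<Longrightarrow> g x (A x v) w = g x v (A x w)"
  unfolding shape_H_def by (rule shape_operator_self_adjoint)

lemma trace_shape_H:
  assumes x: "x \<in> S" and X: "orthonormal_at g x X"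
  shows "(\<Sum>i\<in>UNIV. g x (A x (X i)) (X i)) = 2 * h (F x) (H x) (H x)"
proof -
  have "metric_trace g x (B x) = 2 *\<^sub>R H x" by (simp add: mean_curvature_def)
  then show ?thesis
    using trace_shape_operator[OF x X, of "H x"] inner_form_bilinear[OF inner_cod[OF x]]
    by (simp add: shape_H_def bilinear_lmul)
qed

end

section \<open>Divergence-free endomorphism fields with constant eigenvalues\<close>

lemma sum_over_2: "(\<Sum>i\<in>UNIV. f i) = f (1::2) + f 2"
  by (simp add: UNIV_2)

text \<open>
  The spectral theorem in the plane, in a form that also covers a double eigenvalue: a unit
  eigenvector for \<open>l\<^sub>1\<close> is completed to an orthonormal basis, and self-adjointness makes the second
  basis vector an eigenvector too. Its eigenvalue can only be \<open>l\<^sub>2\<close>: for \<open>l\<^sub>1 \<noteq> l\<^sub>2\<close> the eigenvectors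
  for \<open>l\<^sub>2\<close> are orthogonal to the first basis vector.
\<close>

lemma self_adjoint_eigenbasis:
  fixes g :: "2 form_field" and A :: "real ^ 2 \<Rightarrow> real ^ 2"
  assumes g: "inner_form (g x)" and lin: "linear A"
    and sa: "\<And>v w. g x (A v) w = g x v (A w)"
    and ev: "{\<mu>. \<exists>v. v \<noteq> 0 \<and> A v = \<mu> *\<^sub>R v} = {l\<^sub>1, l\<^sub>2}"
  obtains X where "orthonormal_at g x X" "A (X 1) = l\<^sub>1 *\<^sub>R X 1" "A (X 2) = l\<^sub>2 *\<^sub>R X 2"
proof -
  have bl: "bilinear (g x)" using g by (rule inner_form_bilinear)
  note bs = bilinear_ladd[OF bl] bilinear_radd[OF bl] bilinear_lmul[OF bl] bilinear_rmul[OF bl]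
    bilinear_lsub[OF bl] bilinear_rsub[OF bl]
  have sym: "g x u v = g x v u" for u v using g by (simp add: inner_form_def)
  have "\<exists>v. v \<noteq> 0 \<and> A v = \<mu> *\<^sub>R v" if "\<mu> \<in> {l\<^sub>1, l\<^sub>2}" for \<mu> using ev that by blast
  then obtain v w where v: "v \<noteq> 0" "A v = l\<^sub>1 *\<^sub>R v" and w: "w \<noteq> 0" "A w = l\<^sub>2 *\<^sub>R w"
    by (metis insertI1 insertI2)
  obtain Y where Y: "orthonormal_at g x Y" using orthonormal_exists[of g x, OF g] by blast
  have Y': "g x (Y 1) (Y 1) = 1" "g x (Y 2) (Y 2) = 1" "g x (Y 1) (Y 2) = 0" "g x (Y 2) (Y 1) = 0"
    using Y by (simp_all add: orthonormal_at_def)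
  define a where "a = g x v (Y 1)" define b where "b = g x v (Y 2)"
  have ve: "v = a *\<^sub>R Y 1 + b *\<^sub>R Y 2"
    using orthonormal_expand[of g x, OF g Y, of v] by (simp add: sum_over_2 a_def b_def)
  define r where "r = sqrt (a\<^sup>2 + b\<^sup>2)"
  have "a\<^sup>2 + b\<^sup>2 \<noteq> 0" using v(1) ve by auto
  then have r: "r \<noteq> 0" "r * r = a * a + b * b"
    by (auto simp: r_def power2_eq_square)
  have unit: "a * a / (a * a + b * b) + b * b / (a * a + b * b) = 1"
    using r by (metis add_divide_distrib divide_self mult_eq_0_iff)
  \<comment> \<open>The normalised eigenvector, and its rotation by a right angle with respect to \<open>Y\<close>.\<close>
  define X where "X i = (if i = 1 then (1 / r) *\<^sub>R v else (1 / r) *\<^sub>R (a *\<^sub>R Y 2 - b *\<^sub>R Y 1))" for i :: 2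
  have X12: "X 1 = (1 / r) *\<^sub>R v" "X 2 = (1 / r) *\<^sub>R (a *\<^sub>R Y 2 - b *\<^sub>R Y 1)" by (simp_all add: X_def)
  have gX: "g x (X 1) (X 1) = 1" "g x (X 2) (X 2) = 1" "g x (X 1) (X 2) = 0" "g x (X 2) (X 1) = 0"
    using r unit by (simp_all add: X12 ve bs Y' field_simps)
  have X: "orthonormal_at g x X"
    unfolding orthonormal_at_def forall_2 using gX by simp
  have expand: "u = g x u (X 1) *\<^sub>R X 1 + g x u (X 2) *\<^sub>R X 2" for u
    using orthonormal_expand[of g x, OF g X, of u] by (simp add: sum_over_2)
  have A1: "A (X 1) = l\<^sub>1 *\<^sub>R X 1" by (simp add: X12 linear_cmul[OF lin] v(2))
  define \<mu> where "\<mu> = g x (A (X 2)) (X 2)"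
  have A2: "A (X 2) = \<mu> *\<^sub>R X 2"
    using expand[of "A (X 2)"] by (simp add: sa[of "X 2" "X 1"] A1 bs gX \<mu>_def)
  have "X 2 \<noteq> 0" using gX(2) bilinear_lzero[OF bl] by auto
  then have \<mu>: "\<mu> \<in> {l\<^sub>1, l\<^sub>2}" using A2 ev by blast
  have "\<mu> = l\<^sub>2"
  proof (cases "l\<^sub>1 = l\<^sub>2")
    case True
    then show ?thesis using \<mu> by simp
  next
    case False
    have "l\<^sub>2 * g x w (X 1) = l\<^sub>1 * g x w (X 1)"
      using sa[of w "X 1"] by (simp add: A1 w(2) bs)
    then have "g x w (X 1) = 0" using False by simp
    then have nz: "g x w (X 2) \<noteq> 0" using w(1) expand[of w] by (metis add_0 scale_zero_left)
    have "l\<^sub>2 * g x w (X 2) = \<mu> * g x w (X 2)"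
      using sa[of w "X 2"] by (simp add: A2 w(2) bs)
    then show ?thesis using nz by simp
  qed
  then show thesis using that X A1 A2 by blast
qed

text \<open>
  If \<open>l\<^sub>1 \<noteq> l\<^sub>2\<close>, the derivative of the quadratic equation of \<open>A\<close> kills the diagonal entries of
  \<open>\<nabla>\<^sub>u A\<close> in an eigenbasis: at \<open>e\<^sub>1\<close> it reads \<open>2 l\<^sub>1 m = (l\<^sub>1 + l\<^sub>2) m\<close>. The single remaining
  entry \<open>n(u)\<close> is killed by the divergence.
\<close>

lemma parallel_of_divergence_free:
  fixes g :: "2 form_field" and A :: "real ^ 2 \<Rightarrow> real ^ 2 \<Rightarrow> real ^ 2"
  assumes S: "open S" "x \<in> S" and g: "riemannian_metric_on S g"
    and lin: "\<And>y. y \<in> S \<Longrightarrow> linear (A y)"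
    and sa: "\<And>y v w. y \<in> S \<Longrightarrow> g y (A y v) w = g y v (A y w)"
    and d: "\<And>v. (\<lambda>y. A y v) differentiable (at x)"
    and ev: "\<And>y. y \<in> S \<Longrightarrow> {\<mu>. \<exists>v. v \<noteq> 0 \<and> A y v = \<mu> *\<^sub>R v} = {l\<^sub>1, l\<^sub>2}"
    and div: "divergence g A x = 0"
  shows "nabla_tensor g A x u v = 0"
proof -
  note I = riemannian_metric_inner_form[OF g]
  note bl = inner_form_bilinear[OF I]
  have basis: "\<exists>X. orthonormal_at g y X \<and> A y (X 1) = l\<^sub>1 *\<^sub>R X 1 \<and> A y (X 2) = l\<^sub>2 *\<^sub>R X 2"
    if y: "y \<in> S" for y
    using self_adjoint_eigenbasis[of g y, OF I[OF y] lin[OF y] sa[OF y] ev[OF y]] by blast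
  have expand: "g y w (X 1) *\<^sub>R X 1 + g y w (X 2) *\<^sub>R X 2 = w"
    if "y \<in> S" "orthonormal_at g y X" for y X w
    using orthonormal_expand[of g y, OF I[OF that(1)] that(2), of w] unfolding sum_over_2 by (rule sym)
  obtain X where X: "orthonormal_at g x X" "A x (X 1) = l\<^sub>1 *\<^sub>R X 1" "A x (X 2) = l\<^sub>2 *\<^sub>R X 2"
    using basis[OF S(2)] by blast
  have gX: "g x (X 1) (X 1) = 1" "g x (X 2) (X 2) = 1" "g x (X 1) (X 2) = 0" "g x (X 2) (X 1) = 0"
    using X(1) by (simp_all add: orthonormal_at_def)
  note bx = bilinear_ladd[OF bl[OF S(2)]] bilinear_radd[OF bl[OF S(2)]]
    bilinear_lmul[OF bl[OF S(2)]] bilinear_rmul[OF bl[OF S(2)]]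
  have sym: "g x u v = g x v u" for u v using I[OF S(2)] by (simp add: inner_form_def)
  let ?N = "nabla_tensor g A x"
  have bN: "bilinear ?N" by (rule bilinear_nabla_tensor[OF S g lin d])
  show ?thesis
  proof (cases "l\<^sub>1 = l\<^sub>2")
    case True
    \<comment> \<open>Here \<open>A\<close> is a constant multiple of the identity on all of \<open>S\<close>.\<close>
    have Al: "A y w = l\<^sub>2 *\<^sub>R w" if y: "y \<in> S" for y w
    proof -
      obtain Z where Z: "orthonormal_at g y Z" "A y (Z 1) = l\<^sub>1 *\<^sub>R Z 1" "A y (Z 2) = l\<^sub>2 *\<^sub>R Z 2"
        using basis[OF y] by blast
      have "A y w = A y (g y w (Z 1) *\<^sub>R Z 1 + g y w (Z 2) *\<^sub>R Z 2)"
        by (simp only: expand[OF y Z(1)])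
      also have "\<dots> = l\<^sub>2 *\<^sub>R (g y w (Z 1) *\<^sub>R Z 1 + g y w (Z 2) *\<^sub>R Z 2)"
        by (simp add: linear_add[OF lin[OF y]] linear_cmul[OF lin[OF y]] Z True algebra_simps)
      finally show ?thesis by (simp only: expand[OF y Z(1)])
    qed
    have "frechet_derivative (\<lambda>y. A y v) (at x) = frechet_derivative (\<lambda>y. l\<^sub>2 *\<^sub>R v) (at x)"
      by (rule frechet_derivative_cong_open[OF S Al]) auto
    then show ?thesis
      by (simp add: nabla_tensor_eq Al[OF S(2)] bilinear_rmul[OF bilinear_levi_civita[OF S g]])
  next
    case False
    \<comment> \<open>The characteristic equation holds on both basis vectors, hence everywhere.\<close>
    have q: "g y (A y v) (A y w) = (l\<^sub>1 + l\<^sub>2) * g y (A y v) w - l\<^sub>1 * l\<^sub>2 * g y v w"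
      if y: "y \<in> S" for y v w
    proof -
      obtain Z where Z: "orthonormal_at g y Z" "A y (Z 1) = l\<^sub>1 *\<^sub>R Z 1" "A y (Z 2) = l\<^sub>2 *\<^sub>R Z 2"
        using basis[OF y] by blast
      define a b where "a = g y w (Z 1)" and "b = g y w (Z 2)"
      have w: "w = a *\<^sub>R Z 1 + b *\<^sub>R Z 2" unfolding a_def b_def by (simp only: expand[OF y Z(1)])
      have Aw: "A y w = (a * l\<^sub>1) *\<^sub>R Z 1 + (b * l\<^sub>2) *\<^sub>R Z 2"
        by (simp add: w linear_add[OF lin[OF y]] linear_cmul[OF lin[OF y]] Z)
      have AAw: "A y (A y w) = (a * l\<^sub>1 * l\<^sub>1) *\<^sub>R Z 1 + (b * l\<^sub>2 * l\<^sub>2) *\<^sub>R Z 2"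
        by (simp add: Aw linear_add[OF lin[OF y]] linear_cmul[OF lin[OF y]] Z)
      note br = bilinear_radd[OF bl[OF y]] bilinear_rmul[OF bl[OF y]]
      have gvw: "g y v w = a * g y v (Z 1) + b * g y v (Z 2)" by (subst w) (simp add: br)
      have "g y v (A y (A y w)) = (l\<^sub>1 + l\<^sub>2) * g y v (A y w) - l\<^sub>1 * l\<^sub>2 * g y v w"
        unfolding AAw unfolding Aw by (simp add: br gvw algebra_simps)
      then show ?thesis by (simp add: sa[OF y])
    qed
    note Nq = nabla_tensor_quadratic[where A = A and p = "l\<^sub>1 + l\<^sub>2" and q = "l\<^sub>1 * l\<^sub>2", OF S g d sa q]
    have diag: "g x (?N u (X 1)) (X 1) = 0" "g x (?N u (X 2)) (X 2) = 0" for u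
    proof -
      have "(l\<^sub>1 - l\<^sub>2) * g x (?N u (X 1)) (X 1) = 0"
        using Nq[of u "X 1" "X 1"] by (simp add: X bx sym[of "X 1"] algebra_simps)
      moreover have "(l\<^sub>2 - l\<^sub>1) * g x (?N u (X 2)) (X 2) = 0"
        using Nq[of u "X 2" "X 2"] by (simp add: X bx sym[of "X 2"] algebra_simps)
      ultimately show "g x (?N u (X 1)) (X 1) = 0" "g x (?N u (X 2)) (X 2) = 0" using False by auto
    qed
    define n where "n u = g x (?N u (X 1)) (X 2)" for u
    have n: "g x (?N u (X 2)) (X 1) = n u" for u
      using nabla_tensor_self_adjoint[where A = A, OF S g d sa, of u "X 2" "X 1"] sym[of "X 2"] by (simp add: n_def)
    have N1: "?N u (X 1) = n u *\<^sub>R X 2" and N2: "?N u (X 2) = n u *\<^sub>R X 1" for u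
      using expand[OF S(2) X(1), of "?N u (X 1)", symmetric] expand[OF S(2) X(1), of "?N u (X 2)", symmetric]
      unfolding diag n n_def[symmetric] by simp_all
    have "n (X 1) *\<^sub>R X 2 + n (X 2) *\<^sub>R X 1 = 0"
      using div metric_trace_eq[of g x, OF I[OF S(2)] X(1) bN]
      by (simp add: divergence_def sum_over_2 N1 N2)
    then have "g x (n (X 1) *\<^sub>R X 2 + n (X 2) *\<^sub>R X 1) w = 0" for w
      using bilinear_lzero[OF bl[OF S(2)]] by simp
    from this[of "X 1"] this[of "X 2"] have n0: "n (X 1) = 0" "n (X 2) = 0"
      by (simp_all add: bx gX)
    have z: "?N (X i) (X j) = 0" for i j
      using exhaust_2[of i] exhaust_2[of j] by (auto simp: N1 N2 n0)
    have "?N u v = ?N (g x u (X 1) *\<^sub>R X 1 + g x u (X 2) *\<^sub>R X 2) (g x v (X 1) *\<^sub>R X 1 + g x v (X 2) *\<^sub>R X 2)"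
      by (simp only: expand[OF S(2) X(1)])
    then show ?thesis
      by (simp add: z bilinear_ladd[OF bN] bilinear_radd[OF bN] bilinear_lmul[OF bN] bilinear_rmul[OF bN])
  qed
qed

context local_surface begin

text \<open>
  The trace of \<open>A\<^sub>H\<close> is \<open>2|H|\<^sup>2\<close> and also the sum of the eigenvalues. So the stress-bienergy tensor is
  \<open>4 A\<^sub>H\<close> up to a constant multiple of the identity, and has four times its divergence.
\<close>

lemma parallel_shape_H_local:
  assumes x: "x \<in> S"
    and ev: "\<And>y. y \<in> S \<Longrightarrow> {\<mu>. \<exists>v. v \<noteq> 0 \<and> A y v = \<mu> *\<^sub>R v} = {l\<^sub>1, l\<^sub>2}"
    and bic: "divergence g (stress_bienergy g h F) x = 0"
  shows "nabla_tensor g A x u v = 0"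
proof -
  have tr: "2 * h (F y) (H y) (H y) = l\<^sub>1 + l\<^sub>2" if y: "y \<in> S" for y
  proof -
    obtain X where X: "orthonormal_at g y X" "A y (X 1) = l\<^sub>1 *\<^sub>R X 1" "A y (X 2) = l\<^sub>2 *\<^sub>R X 2"
      using self_adjoint_eigenbasis[of g y, OF inner_dom[OF y] linear_shape_H[OF y]
          shape_H_self_adjoint[OF y] ev[OF y]] by blast
    have "g y (X 1) (X 1) = 1" "g y (X 2) (X 2) = 1" using X(1) by (simp_all add: orthonormal_at_def)
    then show ?thesis
      using trace_shape_H[OF y X(1)] bilinear_lmul[OF inner_form_bilinear[OF inner_dom[OF y]]]
      by (simp add: sum_over_2 X)
  qed
  have sb: "stress_bienergy g h F y v = (- (l\<^sub>1 + l\<^sub>2)) *\<^sub>R v + 4 *\<^sub>R A y v" if "y \<in> S" for y v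
    using tr[OF that] by (simp add: stress_bienergy_def)
  note G = bilinear_levi_civita[OF open_dom x metric_dom]
  have "nabla_tensor g (stress_bienergy g h F) x u v = 4 *\<^sub>R nabla_tensor g A x u v" for u v
  proof -
    have "((\<lambda>y. (- (l\<^sub>1 + l\<^sub>2)) *\<^sub>R v + 4 *\<^sub>R A y v) has_derivative
        (\<lambda>u. 0 + 4 *\<^sub>R frechet_derivative (\<lambda>y. A y v) (at x) u)) (at x)"
      by (intro has_derivative_add has_derivative_const has_derivative_scaleR_right
          has_derivative_frechet differentiable_shape_H x)
    then have "((\<lambda>y. stress_bienergy g h F y v) has_derivative
        (\<lambda>u. 0 + 4 *\<^sub>R frechet_derivative (\<lambda>y. A y v) (at x) u)) (at x)"
      by (rule has_derivative_transform_within_open[OF _ open_dom x]) (simp add: sb)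
    from frechet_derivative_eqI[OF this] show ?thesis
      by (simp add: nabla_tensor_eq sb[OF x] bilinear_radd[OF G] bilinear_rmul[OF G] bilinear_rsub[OF G]
          bilinear_rneg[OF G] algebra_simps)
  qed
  then have "nabla_tensor g (stress_bienergy g h F) x = (\<lambda>u v. 4 *\<^sub>R nabla_tensor g A x u v)"
    by blast
  then have "divergence g (stress_bienergy g h F) x = 4 *\<^sub>R divergence g A x"
    by (simp add: divergence_def metric_trace_def Let_def scaleR_sum_right)
  then have "divergence g A x = 0" using bic by simp
  from parallel_of_divergence_free[OF open_dom x metric_dom linear_shape_H shape_H_self_adjoint
      differentiable_shape_H[OF x] ev this]
  show ?thesis .
qed

end

section \<open>From charts to the surface\<close>

lemma open_local_dom:
  assumes c: "is_chart X c" and d: "is_chart Y d" and f: "continuous_map X Y f"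
  shows "open (local_dom c d f)"
proof -
  have "openin X {p \<in> topspace X. f p \<in> fst d}"
    using openin_continuous_map_preimage[OF f] d by (simp add: is_chart_def)
  then have "openin X (fst c \<inter> {p \<in> topspace X. f p \<in> fst d})"
    using c by (auto simp: is_chart_def)
  moreover have "fst c \<inter> {p \<in> topspace X. f p \<in> fst d} = {p \<in> fst c. f p \<in> fst d}"
    using c openin_subset by (fastforce simp: is_chart_def)
  ultimately have "openin (subtopology X (fst c)) {p \<in> fst c. f p \<in> fst d}"
    using c by (simp add: openin_open_subtopology is_chart_def)
  then have "openin (top_of_set (coords c)) (local_dom c d f)"
    using c homeomorphic_imp_open_map unfolding is_chart_def open_map_def local_dom_def by blast
  then show ?thesis using c openin_open_trans by (auto simp: is_chart_def)
qed

lemma param_coord: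
  assumes c: "is_chart X c" and p: "p \<in> fst c"
  shows "param c (snd c p) = p"
proof -
  have "fst c \<subseteq> topspace X" using c openin_subset by (auto simp: is_chart_def)
  then have "inj_on (snd c) (fst c)"
    using c homeomorphic_imp_injective_map unfolding is_chart_def
    by (metis inf.absorb_iff2 topspace_subtopology)
  then show ?thesis using p by (simp add: param_def)
qed

theorem theorem4p10:
  fixes M :: "('a, 2) rmanifold" and N :: "('b, 'n::finite) rmanifold"
    and \<phi> :: "'a \<Rightarrow> 'b" and l\<^sub>1 l\<^sub>2 :: "'a \<Rightarrow> real"
  assumes "riemannian_manifold M" and "riemannian_manifold N"
    and "isometric_immersion M N \<phi>"
    and "biconservative M N \<phi>"
    and "principal_curvatures M N \<phi> l\<^sub>1 l\<^sub>2"
    and "l\<^sub>1 constant_on topspace (space_of M)"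
    and "l\<^sub>2 constant_on topspace (space_of M)"
  shows "parallel_shape_H M N \<phi>"
  unfolding parallel_shape_H_def
proof (intro ballI allI)
  fix c d x u v
  assume c: "c \<in> atlas M" and d: "d \<in> atlas N" and x: "x \<in> local_dom c d \<phi>"
  let ?S = "local_dom c d \<phi>" and ?F = "local_rep c d \<phi>" and ?g = "metric M c" and ?h = "metric N d"
  have chc: "is_chart (space_of M) c" and chd: "is_chart (space_of N) d"
    using c d assms(1,2) by (auto simp: riemannian_manifold_def)
  have cont: "continuous_map (space_of M) (space_of N) \<phi>" and sm: "smooth_on ?S ?F"
    using c d assms(3) by (auto simp: isometric_immersion_def smooth_map_def)
  have sub: "?S \<subseteq> coords c" by (auto simp: local_dom_def coords_def)
  have gc: "riemannian_metric_on (coords c) ?g" and hd: "riemannian_metric_on (coords d) ?h"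
    using c d assms(1,2) by (auto simp: riemannian_manifold_def)
  have gS: "riemannian_metric_on ?S ?g"
    by (rule riemannian_metric_on_subset[OF gc sub])
  have into: "?F y \<in> coords d" if y: "y \<in> ?S" for y
    using y by (auto simp: local_dom_def local_rep_def coords_def param_coord[OF chc])
  interpret local_surface ?g ?h ?F ?S "coords d"
    using open_local_dom[OF chc chd cont] chd gS hd into sm
    by unfold_locales (auto simp: is_chart_def)
  \<comment> \<open>The eigenvalue functions live on the surface; here they become constants on the chart domain.\<close>
  obtain k\<^sub>1 k\<^sub>2 where k: "\<And>p. p \<in> topspace (space_of M) \<Longrightarrow> l\<^sub>1 p = k\<^sub>1"
      "\<And>p. p \<in> topspace (space_of M) \<Longrightarrow> l\<^sub>2 p = k\<^sub>2"
    using assms(6,7) unfolding constant_on_def by metis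
  have ev: "{\<mu>. \<exists>v. v \<noteq> 0 \<and> shape_H ?g ?h ?F y v = \<mu> *\<^sub>R v} = {k\<^sub>1, k\<^sub>2}" if y: "y \<in> ?S" for y
  proof -
    obtain p where p: "p \<in> fst c" "\<phi> p \<in> fst d" "y = snd c p" using y unfolding local_dom_def by blast
    then have "p \<in> topspace (space_of M)" using chc openin_subset by (auto simp: is_chart_def)
    then show ?thesis
      using assms(5) c d p k unfolding principal_curvatures_def by auto
  qed
  show "nabla_tensor ?g (shape_H ?g ?h ?F) x u v = 0"
    using parallel_shape_H_local[OF x ev] assms(4) c d x by (simp add: biconservative_def)
qed

end
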